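(* In the setting of the context, assume $\mathbf{A}$ and $\tilde{\mathbf{A}}$ are invertible and $\mathbf{Q}_\Delta$ is given by the LU trick. For $k\in\mathbb{N}$ let $\mathbf{T}_{\mathrm{PFASST}}(\mu,k)=\big(\mathbf{I}_{LMN}-\mathbf{T}_C^F\tilde{\mathbf{P}}^{-1}\mathbf{T}_F^C\mathbf{C}\big)\big(\mathbf{I}_{LMN}-\hat{\mathbf{P}}^{-1}\mathbf{C}\big)^k$ be the iteration matrix of PFASST with $k$ pre-smoothing steps. Then there exist constants $c>0$, $c'\ge0$ and $\mu^*>0$ such that for all $\mu\ge\mu^*$, $$\big\|\mathbf{T}_{\mathrm{PFASST}}(\mu,k)\big\|\le c\,\big\|\mathbf{I}_L\otimes(\mathbf{I}_M-\mathbf{Q}_\Delta^{-1}\mathbf{Q})^k\otimes\mathbf{I}_N\big\|+\frac{c'}{\mu}.$$ In particular, for $k\ge M$ the norm of the iteration matrix tends to zero as $\mu\to\infty$.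
   Context: Fix positive integers $L,M,N$ and coarse sizes $\tilde M\le M$, $\tilde N\le N$. $\mathbf{Q}=(q_{m,j})\in\mathbb{R}^{M\times M}$ with $q_{m,j}=\int_0^{\tau_m}\ell_j(s)\,ds$ is the collocation matrix for the (right) Gauss–Radau nodes $0<\tau_1<\dots<\tau_M=1$ on $[0,1]$. LU trick: $\mathbf{Q}^T=\mathbf{L}_Q\mathbf{U}_Q$ with $\mathbf{L}_Q$ unit lower triangular, $\mathbf{U}_Q$ upper triangular, $\mathbf{Q}_\Delta=\mathbf{U}_Q^T$. $\tilde{\mathbf{Q}}_\Delta\in\mathbb{R}^{\tilde M\times\tilde M}$ is the lower-triangular weight matrix of a simpler quadrature rule on the coarse nodes, assumed invertible (standing assumption of the stiff-limit analysis). $\mathbf{A}\in\mathbb{C}^{N\times N}$, $\tilde{\mathbf{A}}\in\mathbb{C}^{\tilde N\times\tilde N}$, $\mu>0$. $\mathbf{N}_M$, $\tilde{\mathbf{N}}_{\tilde M}$ are the $M\times M$, $\tilde M\times\tilde M$ matrices with ones in the last column and zeros elsewhere; $\mathbf{H}=\mathbf{N}_M\otimes\mathbf{I}_N$, $\tilde{\mathbf{H}}=\tilde{\mathbf{N}}_{\tilde M}\otimes\mathbf{I}_{\tilde N}$; $\mathbf{E}\in\mathbb{R}^{L\times L}$ has ones on the first subdiagonal and zeros elsewhere. $\mathbf{C}=\mathbf{I}_{LMN}-\mu\,\mathbf{I}_L\otimes\mathbf{Q}\otimes\mathbf{A}-\mathbf{E}\otimes\mathbf{H}$, $\hat{\mathbf{P}}=\mathbf{I}_{LMN}-\mu\,\mathbf{I}_L\otimes\mathbf{Q}_\Delta\otimes\mathbf{A}$,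 $\tilde{\mathbf{P}}=\mathbf{I}_{L\tilde M\tilde N}-\mu\,\mathbf{I}_L\otimes\tilde{\mathbf{Q}}_\Delta\otimes\tilde{\mathbf{A}}-\mathbf{E}\otimes\tilde{\mathbf{H}}$ (both invertible). $\mathbf{T}_F^C=\mathbf{I}_L\otimes\mathbf{T}_{F,Q}^C\otimes\mathbf{T}_{F,A}^C\in\mathbb{R}^{L\tilde M\tilde N\times LMN}$, $\mathbf{T}_C^F=\mathbf{I}_L\otimes\mathbf{T}_{C,Q}^F\otimes\mathbf{T}_{C,A}^F\in\mathbb{R}^{LMN\times L\tilde M\tilde N}$, with $(\mathbf{E}\otimes\tilde{\mathbf{H}})\mathbf{T}_F^C=\mathbf{T}_F^C(\mathbf{E}\otimes\mathbf{H})$. $\|\cdot\|$ is any induced matrix norm. *)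

theory Defs
  imports "HOL-Analysis.Analysis" "HOL-Computational_Algebra.Polynomial" "Jordan_Normal_Form.Matrix"
begin

definition kron :: "'a::times mat \<Rightarrow> 'a mat \<Rightarrow> 'a mat" where
  "kron A B = mat (dim_row A * dim_row B) (dim_col A * dim_col B)
     (\<lambda>(i,j). A $$ (i div dim_row B, j div dim_col B) * B $$ (i mod dim_row B, j mod dim_col B))"

text \<open>Inverse of a square matrix (meaningful when the matrix is invertible).\<close>
definition minv :: "'a::semiring_1 mat \<Rightarrow> 'a mat" where
  "minv A = (SOME B. B \<in> carrier_mat (dim_row A) (dim_row A) \<and>
                     A * B = 1\<^sub>m (dim_row A) \<and> B * A = 1\<^sub>m (dim_row A))"

definition lower_triangular :: "'a::zero mat \<Rightarrow> bool" where
  "lower_triangular A \<longleftrightarrow> (\<forall>i<dim_row A. \<forall>j<dim_col A. i < j \<longrightarrow> A $$ (i,j) = 0)"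

definition unit_lower_triangular :: "'a::{zero,one} mat \<Rightarrow> bool" where
  "unit_lower_triangular A \<longleftrightarrow> lower_triangular A \<and> (\<forall>i<dim_row A. A $$ (i,i) = 1)"

abbreviation cmat :: "real mat \<Rightarrow> complex mat" where
  "cmat A \<equiv> map_mat complex_of_real A"

definition is_vec_norm :: "nat \<Rightarrow> (complex vec \<Rightarrow> real) \<Rightarrow> bool" where
  "is_vec_norm n nv \<longleftrightarrow>
     (\<forall>v\<in>carrier_vec n. 0 \<le> nv v \<and> (nv v = 0 \<longleftrightarrow> v = 0\<^sub>v n)) \<and>
     (\<forall>c. \<forall>v\<in>carrier_vec n. nv (c \<cdot>\<^sub>v v) = cmod c * nv v) \<and>
     (\<forall>v\<in>carrier_vec n. \<forall>w\<in>carrier_vec n. nv (v + w) \<le> nv v + nv w)"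

definition induced_norm :: "nat \<Rightarrow> (complex vec \<Rightarrow> real) \<Rightarrow> complex mat \<Rightarrow> real" where
  "induced_norm n nv A = Sup {nv (A *\<^sub>v v) / nv v | v. v \<in> carrier_vec n \<and> v \<noteq> 0\<^sub>v n}"

text \<open>Shifted Legendre polynomial on [0,1] (Rodrigues formula), normalised by value 1 at t = 1.\<close>
definition shifted_legendre :: "nat \<Rightarrow> real poly" where
  "shifted_legendre n = Polynomial.smult (1 / fact n) ((pderiv ^^ n) ([:0, -1, 1:] ^ n))"

text \<open>The right Gauss--Radau nodes on [0,1] (containing 1) are the roots of
  shifted_legendre M - shifted_legendre (M-1).\<close>
definition radau_right_poly :: "nat \<Rightarrow> real poly" where
  "radau_right_poly M = shifted_legendre M - shifted_legendre (M - 1)"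

text \<open>0-based: radau_node M m is tau_(m+1); nodes listed in increasing order.\<close>
definition radau_node :: "nat \<Rightarrow> nat \<Rightarrow> real" where
  "radau_node M m = sorted_list_of_set {t. poly (radau_right_poly M) t = 0} ! m"

definition lagrange_basis :: "nat \<Rightarrow> (nat \<Rightarrow> real) \<Rightarrow> nat \<Rightarrow> real \<Rightarrow> real" where
  "lagrange_basis M tau j s = (\<Prod>i\<in>{0..<M} - {j}. (s - tau i) / (tau j - tau i))"

definition coll_Q :: "nat \<Rightarrow> real mat" where
  "coll_Q M = mat M M (\<lambda>(m,j). integral {0 .. radau_node M m} (lagrange_basis M (radau_node M) j))"

definition E_mat :: "nat \<Rightarrow> complex mat" where
  "E_mat L = mat L L (\<lambda>(i,j). if i = Suc j then 1 else 0)"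

definition N_mat :: "nat \<Rightarrow> complex mat" where
  "N_mat M = mat M M (\<lambda>(i,j). if j = M - 1 then 1 else 0)"

definition H_mat :: "nat \<Rightarrow> nat \<Rightarrow> complex mat" where
  "H_mat M N = kron (N_mat M) (1\<^sub>m N)"

definition C_mat :: "nat \<Rightarrow> nat \<Rightarrow> nat \<Rightarrow> real \<Rightarrow> real mat \<Rightarrow> complex mat \<Rightarrow> complex mat" where
  "C_mat L M N \<mu> Q A = 1\<^sub>m (L*M*N) - complex_of_real \<mu> \<cdot>\<^sub>m kron (kron (1\<^sub>m L) (cmat Q)) A
                       - kron (E_mat L) (H_mat M N)"

definition Phat_mat :: "nat \<Rightarrow> nat \<Rightarrow> nat \<Rightarrow> real \<Rightarrow> real mat \<Rightarrow> complex mat \<Rightarrow> complex mat" where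
  "Phat_mat L M N \<mu> QD A = 1\<^sub>m (L*M*N) - complex_of_real \<mu> \<cdot>\<^sub>m kron (kron (1\<^sub>m L) (cmat QD)) A"

definition Ptilde_mat :: "nat \<Rightarrow> nat \<Rightarrow> nat \<Rightarrow> real \<Rightarrow> real mat \<Rightarrow> complex mat \<Rightarrow> complex mat" where
  "Ptilde_mat L Mc Nc \<mu> QDc Ac = C_mat L Mc Nc \<mu> QDc Ac"

definition T_PFASST ::
  "nat \<Rightarrow> nat \<Rightarrow> nat \<Rightarrow> nat \<Rightarrow> nat \<Rightarrow> real mat \<Rightarrow> real mat \<Rightarrow> complex mat \<Rightarrow> complex mat
   \<Rightarrow> complex mat \<Rightarrow> complex mat \<Rightarrow> real \<Rightarrow> nat \<Rightarrow> complex mat" where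
  "T_PFASST L M N Mc Nc QD QDc A Ac TFC TCF \<mu> k =
     (1\<^sub>m (L*M*N) - TCF * minv (Ptilde_mat L Mc Nc \<mu> QDc Ac) * TFC * C_mat L M N \<mu> (coll_Q M) A)
     * (1\<^sub>m (L*M*N) - minv (Phat_mat L M N \<mu> QD A) * C_mat L M N \<mu> (coll_Q M) A) ^\<^sub>m k"

end

theory Submission
  imports Defs "Jordan_Normal_Form.Determinant"
begin

text \<open>The transposed LU factorisation gives \<open>Q = Q\<^sub>\<Delta> L\<^sub>Q\<^sup>T\<close>, so \<open>I - Q\<^sub>\<Delta>\<^sup>-\<^sup>1 Q = I - L\<^sub>Q\<^sup>T\<close> is strictly
  upper triangular, hence nilpotent of index at most \<open>M\<close>. That \<open>Q\<^sub>\<Delta>\<close> is invertible rests on the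
  collocation matrix being invertible, which needs \<open>M\<close> distinct positive Radau nodes; these come
  from Rolle's theorem applied to the Rodrigues formula
  \<open>P\<^sub>M - P\<^sub>M\<^sub>-\<^sub>1 = 2/(M-1)! D\<^sup>M\<^sup>-\<^sup>1 (x\<^sup>M\<^sup>-\<^sup>1 (x-1)\<^sup>M)\<close>. For large \<open>\<mu>\<close> both preconditioners have inverses of
  size \<open>O(1/\<mu>)\<close>, so the coarse correction stays bounded and each smoothing step is an \<open>O(1/\<mu>)\<close>
  perturbation of \<open>I \<otimes> (I - Q\<^sub>\<Delta>\<^sup>-\<^sup>1 Q) \<otimes> I\<close>; equivalence of norms transfers the estimates to the
  given induced norm.\<close>

unbundle no vec_syntax

subsection \<open>Radau nodes and the collocation matrix\<close>

lemma linear_power_dvd_pderiv: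
  fixes p :: "'a::{idom,ring_char_0} poly"
  assumes "[:-a, 1:] ^ Suc m dvd p"
  shows "[:-a, 1:] ^ m dvd pderiv p"
proof -
  obtain r where "p = [:-a, 1:] ^ Suc m * r" using assms by (auto elim: dvdE)
  hence "pderiv p = [:-a, 1:] ^ m * ([:-a, 1:] * pderiv r + Polynomial.smult (of_nat (Suc m)) r)"
    by (simp add: pderiv_mult pderiv_power_Suc pderiv_pCons algebra_simps del: power_Suc)
       (simp add: algebra_simps)
  thus ?thesis by simp
qed

lemma linear_power_dvd_higher_pderiv:
  fixes p :: "'a::{idom,ring_char_0} poly"
  assumes "[:-a, 1:] ^ (m + j) dvd p"
  shows "[:-a, 1:] ^ m dvd (pderiv ^^ j) p"
  using assms
proof (induction j arbitrary: m)
  case (Suc j)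
  then have "[:-a, 1:] ^ Suc m dvd (pderiv ^^ j) p" by (metis add_Suc_shift)
  from linear_power_dvd_pderiv[OF this] show ?case by simp
qed simp

text \<open>Each differentiation lowers the multiplicity of the root \<open>a\<close> by at most
  one, so after \<open>j < m\<close> of them at least one linear factor is left.\<close>

lemma poly_higher_pderiv_eq_0:
  fixes p :: "'a::{idom,ring_char_0} poly"
  assumes "[:-a, 1:] ^ m dvd p" "j < m"
  shows "poly ((pderiv ^^ j) p) a = 0"
proof -
  have "[:-a, 1:] ^ (1 + j) dvd [:-a, 1:] ^ m" by (rule le_imp_power_dvd) (use assms in simp)
  also note assms(1)
  finally have "[:-a, 1:] ^ (1 + j) dvd p" .
  from linear_power_dvd_higher_pderiv[OF this] show ?thesis by (simp add: poly_eq_0_iff_dvd)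
qed

text \<open>Induction splits off the largest point \<open>b\<close>: the remaining points yield
  zeros below their maximum \<open>a\<close>, and one more zero lies strictly between
  \<open>a\<close> and \<open>b\<close>. The open interval in the conclusion is what keeps the new
  zero distinct from the earlier ones.\<close>

lemma Rolle_roots_pderiv:
  fixes p :: "real poly"
  assumes "finite S" "card S = Suc k" "\<forall>x\<in>S. poly p x = 0"
  shows "\<exists>T \<subseteq> {Min S<..<Max S}. finite T \<and> card T = k \<and> (\<forall>x\<in>T. poly (pderiv p) x = 0)"
  using assms
proof (induction k arbitrary: S)
  case 0
  thus ?case by (intro exI[of _ "{}"]) auto
next
  case (Suc k)
  define b where "b = Max S"
  define S' where "S' = S - {b}"
  have ne: "S \<noteq> {}" using Suc.prems by auto
  have b: "b \<in> S" unfolding b_def using Suc.prems ne by (intro Max_in) auto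
  have card: "card S' = Suc k" "finite S'" using Suc.prems b by (auto simp: S'_def)
  hence ne': "S' \<noteq> {}" by auto
  define a where "a = Max S'"
  have a: "a \<in> S'" unfolding a_def using card ne' by (intro Max_in) auto
  hence ab: "a < b" using Suc.prems(1) by (auto simp: S'_def b_def less_le)
  from Suc.IH[OF card(2,1)] Suc.prems(3) obtain T where
    T: "T \<subseteq> {Min S'<..<a}" "finite T" "card T = k" "\<forall>x\<in>T. poly (pderiv p) x = 0"
    by (auto simp: S'_def a_def)
  obtain x where x: "a < x" "x < b" "poly p b - poly p a = (b - a) * poly (pderiv p) x"
    using poly_MVT[OF ab] by blast
  have x0: "poly (pderiv p) x = 0" using x(3) ab a b Suc.prems(3) by (auto simp: S'_def)
  have min: "Min S \<le> Min S'" using ne' Suc.prems(1) by (intro Min_antimono) (auto simp: S'_def)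
  have "Min S' \<le> a" using a card by simp
  moreover have "x \<notin> T" using T x by auto
  ultimately show ?case using T x x0 min
    by (intro exI[of _ "insert x T"]) (fastforce simp: b_def)
qed

text \<open>One derivative of the higher Legendre polynomial is carried out, so that both terms
  become \<open>n\<close>-fold derivatives and can be subtracted under the derivative. In the
  resulting single formula the factor at 1 has one power more than the factor at 0.\<close>

lemma radau_right_poly_Rodrigues:
  "radau_right_poly (Suc n) =
     Polynomial.smult (2 / fact n) ((pderiv ^^ n) ([:0, 1:] ^ n * [:-1, 1:] ^ Suc n))"
proof -
  define q :: "real poly" where "q = [:0, -1, 1:]"
  have q: "q = [:0, 1:] * [:-1, 1:]" by (simp add: q_def)
  have dq: "pderiv q = [:-1, 2:]" by (simp add: q_def pderiv_pCons)
  have c: "real (Suc n) / fact (Suc n) = 1 / fact n"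
    by (simp add: fact_Suc del: of_nat_Suc)
  have "shifted_legendre (Suc n) = Polynomial.smult (1 / fact (Suc n)) ((pderiv ^^ n) (pderiv (q ^ Suc n)))"
    by (simp add: shifted_legendre_def q_def funpow_swap1)
  also have "pderiv (q ^ Suc n) = Polynomial.smult (real (Suc n)) (q ^ n * [:-1, 2:])"
    by (simp only: pderiv_power_Suc dq mult_smult_left)
  also have "Polynomial.smult (1 / fact (Suc n)) ((pderiv ^^ n) \<dots>)
      = Polynomial.smult (1 / fact n) ((pderiv ^^ n) (q ^ n * [:-1, 2:]))"
    using c by (simp only: higher_pderiv_smult smult_smult) simp
  finally have 1: "shifted_legendre (Suc n) = Polynomial.smult (1 / fact n) ((pderiv ^^ n) (q ^ n * [:-1, 2:]))" .
  have 2: "shifted_legendre n = Polynomial.smult (1 / fact n) ((pderiv ^^ n) (q ^ n))"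
    by (simp add: shifted_legendre_def q_def)
  \<comment> \<open>The splitting 2x - 1 = 2(x - 1) + 1: the summand 1 reproduces the Legendre
    polynomial of degree \<open>n\<close>, which the difference removes.\<close>
  have e: "q ^ n * [:-1, 2:] = Polynomial.smult 2 ([:0, 1:] ^ n * [:-1, 1:] ^ Suc n) + q ^ n"
  proof -
    have "Polynomial.smult 2 ([:0, 1:] ^ n * [:-1, 1:] ^ Suc n) + q ^ n
        = q ^ n * (Polynomial.smult 2 [:-1, 1:] + 1)"
      by (simp only: q power_mult_distrib power_Suc mult_smult_right ring_distribs mult_ac mult_1_right)
    thus ?thesis by (simp add: one_pCons)
  qed
  show ?thesis
    unfolding radau_right_poly_def
    by (simp only: diff_Suc_1 1 2 e higher_pderiv_add higher_pderiv_smult smult_add_right smult_smult) simp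
qed

text \<open>Both endpoints stay zeros of the \<open>j\<close>-th derivative of \<open>f\<close>
  while \<open>j < n\<close>, so Rolle adds one interior zero per derivative. The \<open>n\<close>
  interior zeros reached at \<open>j = n\<close>, together with the endpoint 1, exhaust the
  degree.\<close>

lemma radau_roots:
  assumes "0 < M"
  defines "R \<equiv> {t. poly (radau_right_poly M) t = 0}"
  shows "finite R" "card R = M" "R \<subseteq> {0<..1}"
proof -
  obtain n where M: "M = Suc n" using assms by (cases M) auto
  define f :: "real poly" where "f = [:0, 1:] ^ n * [:-1, 1:] ^ Suc n"
  have rp: "radau_right_poly M = Polynomial.smult (2 / fact n) ((pderiv ^^ n) f)"
    unfolding M f_def by (rule radau_right_poly_Rodrigues)
  have R: "R = {t. poly ((pderiv ^^ n) f) t = 0}" by (simp add: R_def rp)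
  have degf: "degree f = 2 * n + 1"
    unfolding f_def by (simp add: degree_mult_eq degree_power_eq del: power_Suc)
  have deg: "degree ((pderiv ^^ n) f) = Suc n" by (simp add: degree_higher_pderiv degf)
  hence nz: "(pderiv ^^ n) f \<noteq> 0" by auto
  \<comment> \<open>The multiplicities \<open>n + 1\<close> at 1 and \<open>n\<close> at 0 differ by
    one: the zero at 1 survives all \<open>n\<close> derivatives, while the one at 0 is guaranteed
    only up to \<open>n - 1\<close>.\<close>
  have z1: "poly ((pderiv ^^ j) f) 1 = 0" if "j \<le> n" for j
    by (rule poly_higher_pderiv_eq_0[where m = "Suc n"]) (use that in \<open>auto simp: f_def simp del: power_Suc\<close>)
  have z0: "poly ((pderiv ^^ j) f) 0 = 0" if "j < n" for j
    by (rule poly_higher_pderiv_eq_0[where m = n]) (use that in \<open>auto simp: f_def\<close>)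
  have "\<exists>S \<subseteq> {0<..<1}. finite S \<and> card S = j \<and> (\<forall>x\<in>S. poly ((pderiv ^^ j) f) x = 0)" if "j \<le> n" for j
    using that
  proof (induction j)
    case 0
    show ?case by (intro exI[of _ "{}"]) auto
  next
    case (Suc j)
    then obtain S where S: "S \<subseteq> {0<..<1}" "finite S" "card S = j" "\<forall>x\<in>S. poly ((pderiv ^^ j) f) x = 0"
      by auto
    let ?S = "insert 0 (insert 1 S)"
    have "finite ?S" "card ?S = Suc (Suc j)" "\<forall>x\<in>?S. poly ((pderiv ^^ j) f) x = 0"
      using S z0[of j] z1[of j] Suc.prems by (auto simp: card_insert_if)
    from Rolle_roots_pderiv[OF this] obtain T where
      T: "T \<subseteq> {Min ?S<..<Max ?S}" "finite T" "card T = Suc j"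
         "\<forall>x\<in>T. poly (pderiv ((pderiv ^^ j) f)) x = 0" by auto
    have "0 \<le> Min ?S" "Max ?S \<le> 1" using S by auto
    with T have "T \<subseteq> {0<..<1}" by fastforce
    thus ?case using T by (intro exI[of _ T]) auto
  qed
  from this[of n] obtain S where
    S: "S \<subseteq> {0<..<1}" "finite S" "card S = n" "\<forall>x\<in>S. poly ((pderiv ^^ n) f) x = 0" by auto
  show fin: "finite R" unfolding R by (rule poly_roots_finite[OF nz])
  have sub: "insert 1 S \<subseteq> R" using S z1[of n] by (auto simp: R)
  have c: "card (insert 1 S) = M" using S by (auto simp: card_insert_if M)
  \<comment> \<open>The degree allows no more than \<open>M\<close> roots, so the \<open>M\<close>
    roots already found are all of them, and their location carries over to
    \<open>R\<close>.\<close>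
  have le: "card R \<le> M" using card_poly_roots_bound[OF nz] by (simp add: R deg M)
  have eq: "insert 1 S = R" using card_seteq[OF fin sub] c le by simp
  show "card R = M" using eq c by simp
  show "R \<subseteq> {0<..1}" using eq S by auto
qed

text \<open>There are exactly \<open>M\<close> roots, so an index below \<open>M\<close> is inside
  the sorted list and \<open>!\<close> returns a genuine root.\<close>

lemma radau_node_pos:
  assumes "m < M"
  shows "0 < radau_node M m"
proof -
  let ?R = "{t. poly (radau_right_poly M) t = 0}"
  have "0 < M" using assms by simp
  note R = radau_roots[OF this]
  have "radau_node M m \<in> set (sorted_list_of_set ?R)"
    unfolding radau_node_def using assms R by (intro nth_mem) simp
  thus ?thesis using R by auto
qed

lemma inj_on_radau_node: "inj_on (radau_node M) {0..<M}"
proof (cases "M = 0")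
  case False
  let ?R = "{t. poly (radau_right_poly M) t = 0}"
  note R = radau_roots[of M]
  have "length (sorted_list_of_set ?R) = M" "distinct (sorted_list_of_set ?R)"
    using R False by auto
  thus ?thesis unfolding radau_node_def inj_on_def by (auto simp: nth_eq_iff_index_eq)
qed simp

text \<open>Termwise integration. The normalisation at 0 makes the value at \<open>t\<close> the
  integral over [0, t], and the degree bound serves to count roots.\<close>

lemma poly_antiderivative:
  fixes p :: "real poly"
  obtains P where "pderiv P = p" "poly P 0 = 0" "degree P \<le> Suc (degree p)"
proof
  define P where "P = (\<Sum>i\<le>degree p. monom (coeff p i / real (Suc i)) (Suc i))"
  have "pderiv P = (\<Sum>i\<le>degree p. monom (coeff p i) i)"
    by (simp add: P_def higher_pderiv_sum[of 1, simplified] pderiv_monom del: of_nat_Suc)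
  thus "pderiv P = p" by (simp add: poly_as_sum_of_monoms)
  show "poly P 0 = 0" by (simp add: P_def poly_sum poly_monom)
  show "degree P \<le> Suc (degree p)" unfolding P_def
    by (rule degree_sum_le) (auto intro: order_trans[OF degree_monom_le])
qed

text \<open>Makes degree and antiderivative available for a function defined by a product. Bounding
  the degree by a cardinality covers every index \<open>j\<close>, also those outside the node
  range.\<close>

lemma lagrange_basis_poly:
  obtains l where "poly l = lagrange_basis M tau j" "degree l \<le> card ({0..<M} - {j})"
proof
  let ?f = "\<lambda>i. Polynomial.smult (1 / (tau j - tau i)) [:- tau i, 1:]"
  define l where "l = (\<Prod>i\<in>{0..<M} - {j}. ?f i)"
  show "poly l = lagrange_basis M tau j"
    unfolding l_def lagrange_basis_def poly_prod fun_eq_iff by (intro allI prod.cong) (auto simp: diff_divide_distrib)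
  have "degree l \<le> (\<Sum>i\<in>{0..<M} - {j}. degree (?f i))"
    unfolding l_def using degree_prod_sum_le[of "{0..<M} - {j}" ?f] by (simp add: o_def)
  also have "\<dots> \<le> (\<Sum>i\<in>{0..<M} - {j}. 1)" by (rule sum_mono) auto
  finally show "degree l \<le> card ({0..<M} - {j})" by simp
qed

lemma lagrange_basis_node:
  assumes "inj_on tau {0..<M}" "i < M" "j < M"
  shows "lagrange_basis M tau j (tau i) = (if i = j then 1 else 0)"
proof (cases "i = j")
  case True
  have "tau j \<noteq> tau l" if "l \<in> {0..<M} - {j}" for l
    using assms that by (auto simp: inj_on_def)
  thus ?thesis using True by (auto simp: lagrange_basis_def intro!: prod.neutral)
next
  case False
  have "lagrange_basis M tau j (tau i) = 0"
    unfolding lagrange_basis_def using assms False by (intro prod_zero) auto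
  thus ?thesis using False by simp
qed

lemma coll_Q_carrier [simp]: "coll_Q M \<in> carrier_mat M M"
  by (simp add: coll_Q_def)

text \<open>A kernel vector is the nodal vector of a polynomial of degree less than \<open>M\<close> whose
  antiderivative vanishes at \<open>0\<close> and at the \<open>M\<close> positive nodes.\<close>
lemma det_coll_Q_nonzero:
  assumes "0 < M"
  shows "Determinant.det (coll_Q M) \<noteq> 0"
proof
  assume "Determinant.det (coll_Q M) = 0"
  then obtain v where v: "v \<in> carrier_vec M" "v \<noteq> 0\<^sub>v M" "coll_Q M *\<^sub>v v = 0\<^sub>v M"
    by (auto simp: det_0_iff_vec_prod_zero_field[OF coll_Q_carrier])
  let ?tau = "radau_node M"
  have "\<exists>l. poly l = lagrange_basis M ?tau j \<and> degree l \<le> card ({0..<M} - {j})" for j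
    by (meson lagrange_basis_poly)
  then obtain l where l: "\<And>j. poly (l j) = lagrange_basis M ?tau j"
      "\<And>j. degree (l j) \<le> card ({0..<M} - {j})" by metis
  define p where "p = (\<Sum>j<M. Polynomial.smult (v $ j) (l j))"
  have degp: "degree p \<le> M - 1" unfolding p_def
  proof (intro degree_sum_le)
    fix j assume "j \<in> {..<M}"
    hence "degree (l j) \<le> M - 1" using l(2)[of j] by simp
    thus "degree (Polynomial.smult (v $ j) (l j)) \<le> M - 1" by (rule order_trans[OF degree_smult_le])
  qed simp
  obtain P where P: "pderiv P = p" "poly P 0 = 0" "degree P \<le> Suc (degree p)"
    by (rule poly_antiderivative)
  have ftc: "(poly p has_integral poly P t) {0..t}" if "0 \<le> t" for t
  proof -
    have "(poly p has_integral (poly P t - poly P 0)) {0..t}"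
      by (rule fundamental_theorem_of_calculus[OF that])
         (auto simp flip: has_real_derivative_iff_has_vector_derivative P(1)
               intro: poly_DERIV DERIV_subset)
    thus ?thesis by (simp add: P)
  qed
  \<comment> \<open>Row \<open>m\<close> of the collocation matrix integrates the interpolant
    \<open>p\<close> of the nodal values \<open>v\<close> up to node \<open>m\<close>.\<close>
  have Pnode: "poly P (?tau m) = 0" if m: "m < M" for m
  proof -
    have t0: "0 \<le> ?tau m" using radau_node_pos[OF m] by simp
    have "0 = (coll_Q M *\<^sub>v v) $ m" using v m by simp
    also have "\<dots> = (\<Sum>j<M. integral {0..?tau m} (poly (l j)) * v $ j)"
      using v(1) m by (simp add: coll_Q_def scalar_prod_def atLeast0LessThan l)
    also have "\<dots> = (\<Sum>j<M. integral {0..?tau m} (\<lambda>s. v $ j * poly (l j) s))"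
      by (simp add: mult.commute)
    also have "\<dots> = integral {0..?tau m} (\<lambda>s. \<Sum>j<M. v $ j * poly (l j) s)"
      by (rule integral_sum[symmetric]) (auto intro!: integrable_continuous_real continuous_intros)
    also have "(\<lambda>s. \<Sum>j<M. v $ j * poly (l j) s) = poly p"
      by (simp add: p_def poly_sum fun_eq_iff)
    also have "integral {0..?tau m} (poly p) = poly P (?tau m)"
      using ftc[OF t0] by (rule integral_unique)
    finally show ?thesis by simp
  qed
  have "P = 0"
  proof (rule ccontr)
    assume nz: "P \<noteq> 0"
    let ?S = "insert 0 (?tau ` {0..<M})"
    \<comment> \<open>Since 0 is not a node, there are \<open>M + 1\<close> distinct roots, whereas
      \<open>degree P\<close> is at most \<open>M\<close>.\<close>
    have "0 \<notin> ?tau ` {0..<M}" using radau_node_pos[of _ M] by force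
    hence "card ?S = Suc M" by (simp add: card_image[OF inj_on_radau_node])
    moreover have "card ?S \<le> card {x. poly P x = 0}"
      using P(2) Pnode by (intro card_mono poly_roots_finite nz) auto
    moreover have "\<dots> \<le> degree P" by (rule card_poly_roots_bound[OF nz])
    ultimately show False using P(3) degp assms by simp
  qed
  hence p0: "p = 0" using P(1) by simp
  \<comment> \<open>The components of \<open>v\<close> are recovered as the values of the
    interpolant at the nodes.\<close>
  have "v $ i = 0" if i: "i < M" for i
  proof -
    have "0 = poly p (?tau i)" by (simp add: p0)
    also have "\<dots> = (\<Sum>j<M. v $ j * (if i = j then 1 else 0))"
      unfolding p_def poly_sum
      by (rule sum.cong) (auto simp: l(1) lagrange_basis_node[OF inj_on_radau_node i])
    also have "\<dots> = v $ i" using i by (subst sum.remove[of _ i]) auto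
    finally show ?thesis by simp
  qed
  hence "v = 0\<^sub>v M" using v(1) by (intro eq_vecI) auto
  with v show False by simp
qed

subsection \<open>Kronecker products and inverses\<close>

lemma kron_carrier [simp, intro]:
  "A \<in> carrier_mat a b \<Longrightarrow> B \<in> carrier_mat c d \<Longrightarrow> kron A B \<in> carrier_mat (a * c) (b * d)"
  by (rule carrier_matI) (simp_all add: kron_def)

lemma index_kron:
  assumes "A \<in> carrier_mat a b" "B \<in> carrier_mat c d" "i < a * c" "j < b * d"
  shows "kron A B $$ (i, j) = A $$ (i div c, j div d) * B $$ (i mod c, j mod d)"
proof -
  have "dim_row A = a" "dim_col A = b" "dim_row B = c" "dim_col B = d" using assms by auto
  thus ?thesis using assms(3,4) unfolding kron_def by simp
qed

lemma div_mod_less_mult: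
  fixes i :: nat
  assumes "i < a * b"
  shows "i div b < a" "i mod b < b"
proof -
  show "i div b < a" by (rule less_mult_imp_div_less[OF assms])
  have "0 < b" using assms by (cases b) auto
  thus "i mod b < b" by simp
qed

text \<open>Cuts the index range into \<open>m\<close> blocks of length \<open>n\<close>; this
  splits the contraction index of a product of Kronecker products into its two parts.\<close>

lemma sum_nat_div_mod:
  fixes f :: "nat \<Rightarrow> nat \<Rightarrow> 'a::comm_monoid_add"
  shows "(\<Sum>k<m * n. f (k div n) (k mod n)) = (\<Sum>a<m. \<Sum>b<n. f a b)"
proof -
  have "(\<Sum>k<m * n. f (k div n) (k mod n)) = (\<Sum>a<m. \<Sum>k\<in>{a * n..<a * n + n}. f (k div n) (k mod n))"
    by (rule sum.nat_group[symmetric])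
  also have "\<dots> = (\<Sum>a<m. \<Sum>b<n. f a b)"
  proof (rule sum.cong[OF refl])
    fix a
    have "(\<Sum>k\<in>{a * n..<a * n + n}. f (k div n) (k mod n))
        = (\<Sum>b\<in>{0..<n}. f ((b + a * n) div n) ((b + a * n) mod n))"
      using sum.shift_bounds_nat_ivl[of "\<lambda>k. f (k div n) (k mod n)" 0 "a * n" n] by (simp add: add.commute)
    also have "\<dots> = (\<Sum>b<n. f a b)" by (rule sum.cong) auto
    finally show "(\<Sum>k\<in>{a * n..<a * n + n}. f (k div n) (k mod n)) = (\<Sum>b<n. f a b)" .
  qed
  finally show ?thesis .
qed

text \<open>The mixed-product property: once the contraction index is split into quotient and
  remainder, the double sum factorises.\<close>

lemma kron_mult_kron:
  fixes A :: "'a::comm_semiring_0 mat"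
  assumes A: "A \<in> carrier_mat a b" and B: "B \<in> carrier_mat c d"
    and A': "A' \<in> carrier_mat b e" and B': "B' \<in> carrier_mat d f"
  shows "kron A B * kron A' B' = kron (A * A') (B * B')"
proof (rule eq_matI)
  have K: "kron A B \<in> carrier_mat (a * c) (b * d)" "kron A' B' \<in> carrier_mat (b * d) (e * f)"
    "A * A' \<in> carrier_mat a e" "B * B' \<in> carrier_mat c f"
    using assms by auto
  have K': "kron (A * A') (B * B') \<in> carrier_mat (a * c) (e * f)" using K by auto
  show "dim_row (kron A B * kron A' B') = dim_row (kron (A * A') (B * B'))"
       "dim_col (kron A B * kron A' B') = dim_col (kron (A * A') (B * B'))"
    using K(1,2) carrier_matD[OF K'] by auto
  fix i j assume "i < dim_row (kron (A * A') (B * B'))" "j < dim_col (kron (A * A') (B * B'))"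
  hence i: "i < a * c" and j: "j < e * f" using K' by auto
  note id = div_mod_less_mult[OF i] and jd = div_mod_less_mult[OF j]
  have "(kron A B * kron A' B') $$ (i, j) = (\<Sum>k<b * d. kron A B $$ (i, k) * kron A' B' $$ (k, j))"
    using K i j by (auto simp: scalar_prod_def atLeast0LessThan)
  also have "\<dots> = (\<Sum>k<b * d. (A $$ (i div c, k div d) * B $$ (i mod c, k mod d)) *
                                (A' $$ (k div d, j div f) * B' $$ (k mod d, j mod f)))"
    by (rule sum.cong) (use i j in \<open>auto simp: index_kron[OF A B] index_kron[OF A' B']\<close>)
  also have "\<dots> = (\<Sum>x<b. \<Sum>y<d. (A $$ (i div c, x) * B $$ (i mod c, y)) * (A' $$ (x, j div f) * B' $$ (y, j mod f)))"
    by (rule sum_nat_div_mod)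
  also have "\<dots> = (\<Sum>x<b. A $$ (i div c, x) * A' $$ (x, j div f)) * (\<Sum>y<d. B $$ (i mod c, y) * B' $$ (y, j mod f))"
    by (simp add: sum_product mult_ac)
  also have "\<dots> = (A * A') $$ (i div c, j div f) * (B * B') $$ (i mod c, j mod f)"
    using A A' B B' id jd by (simp add: scalar_prod_def atLeast0LessThan)
  also have "\<dots> = kron (A * A') (B * B') $$ (i, j)" by (rule index_kron[OF K(3,4) i j, symmetric])
  finally show "(kron A B * kron A' B') $$ (i, j) = kron (A * A') (B * B') $$ (i, j)" .
qed

lemma kron_one: "kron (1\<^sub>m a) (1\<^sub>m b) = (1\<^sub>m (a * b) :: 'a::semiring_1 mat)"
proof (rule eq_matI)
  fix i j assume "i < dim_row (1\<^sub>m (a * b) :: 'a mat)" "j < dim_col (1\<^sub>m (a * b) :: 'a mat)"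
  hence ij: "i < a * b" "j < a * b" by auto
  have "i div b = j div b \<and> i mod b = j mod b \<longleftrightarrow> i = j" by (metis div_mult_mod_eq)
  thus "kron (1\<^sub>m a) (1\<^sub>m b) $$ (i, j) = (1\<^sub>m (a * b) :: 'a mat) $$ (i, j)"
    using ij div_mod_less_mult[OF ij(1)] div_mod_less_mult[OF ij(2)]
    by (auto simp: index_kron[OF one_carrier_mat one_carrier_mat])
qed (simp_all add: kron_def)

lemma kron_zero_right:
  fixes B :: "'a::mult_zero mat"
  assumes "B \<in> carrier_mat c d"
  shows "kron B (0\<^sub>m a b) = 0\<^sub>m (c * a) (d * b)"
proof (rule eq_matI)
  fix i j assume "i < dim_row (0\<^sub>m (c * a) (d * b) :: 'a mat)" "j < dim_col (0\<^sub>m (c * a) (d * b) :: 'a mat)"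
  hence ij: "i < c * a" "j < d * b" using assms by (auto simp: kron_def)
  show "kron B (0\<^sub>m a b) $$ (i, j) = (0\<^sub>m (c * a) (d * b) :: 'a mat) $$ (i, j)"
    using assms ij div_mod_less_mult[OF ij(1)] div_mod_less_mult[OF ij(2)]
    by (simp add: kron_def)
qed (use assms in \<open>simp_all add: kron_def\<close>)

lemma kron_zero_left:
  fixes B :: "'a::mult_zero mat"
  assumes "B \<in> carrier_mat c d"
  shows "kron (0\<^sub>m a b) B = 0\<^sub>m (a * c) (b * d)"
proof (rule eq_matI)
  fix i j assume "i < dim_row (0\<^sub>m (a * c) (b * d) :: 'a mat)" "j < dim_col (0\<^sub>m (a * c) (b * d) :: 'a mat)"
  hence ij: "i < a * c" "j < b * d" using assms by (auto simp: kron_def)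
  show "kron (0\<^sub>m a b) B $$ (i, j) = (0\<^sub>m (a * c) (b * d) :: 'a mat) $$ (i, j)"
    using assms ij div_mod_less_mult[OF ij(1)] div_mod_less_mult[OF ij(2)]
    by (simp add: kron_def)
qed (use assms in \<open>simp_all add: kron_def\<close>)

lemma kron_minus_right:
  fixes B :: "'a::ring mat"
  assumes "A \<in> carrier_mat a b" "B \<in> carrier_mat c d" "B' \<in> carrier_mat c d"
  shows "kron A (B - B') = kron A B - kron A B'"
proof (rule eq_matI)
  fix i j assume "i < dim_row (kron A B - kron A B')" "j < dim_col (kron A B - kron A B')"
  hence ij: "i < a * c" "j < b * d" using assms by (auto simp: kron_def)
  show "kron A (B - B') $$ (i, j) = (kron A B - kron A B') $$ (i, j)"
    using assms ij div_mod_less_mult[OF ij(1)] div_mod_less_mult[OF ij(2)]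
    by (simp add: kron_def right_diff_distrib)
qed (use assms in \<open>simp_all add: kron_def\<close>)

lemma kron_minus_left:
  fixes B :: "'a::ring mat"
  assumes "A \<in> carrier_mat a b" "B \<in> carrier_mat c d" "B' \<in> carrier_mat c d"
  shows "kron (B - B') A = kron B A - kron B' A"
proof (rule eq_matI)
  fix i j assume "i < dim_row (kron B A - kron B' A)" "j < dim_col (kron B A - kron B' A)"
  hence ij: "i < c * a" "j < d * b" using assms by (auto simp: kron_def)
  show "kron (B - B') A $$ (i, j) = (kron B A - kron B' A) $$ (i, j)"
    using assms ij div_mod_less_mult[OF ij(1)] div_mod_less_mult[OF ij(2)]
    by (simp add: kron_def left_diff_distrib)
qed (use assms in \<open>simp_all add: kron_def\<close>)

lemma one_mat_pow: "(1\<^sub>m n :: 'a::semiring_1 mat) ^\<^sub>m k = 1\<^sub>m n"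
  by (induction k) simp_all

lemma kron_pow:
  fixes A :: "'a::comm_semiring_1 mat"
  assumes "A \<in> carrier_mat a a" "B \<in> carrier_mat b b"
  shows "kron A B ^\<^sub>m k = kron (A ^\<^sub>m k) (B ^\<^sub>m k)"
proof (induction k)
  case 0
  have "dim_row (kron A B) = a * b" using assms by (simp add: kron_def)
  thus ?case using assms by (simp add: kron_one)
next
  case (Suc k)
  have "A ^\<^sub>m k \<in> carrier_mat a a" "B ^\<^sub>m k \<in> carrier_mat b b" using assms by auto
  from kron_mult_kron[OF this assms] show ?case by (simp add: Suc)
qed

text \<open>\<open>invertible_mat\<close> leaves the shape of the inverse implicit; comparing the
  dimensions of both sides of the two identities recovers it.\<close>

lemma invertible_matE:
  fixes A :: "'a::semiring_1 mat"
  assumes "invertible_mat A" "A \<in> carrier_mat n n"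
  obtains B where "B \<in> carrier_mat n n" "A * B = 1\<^sub>m n" "B * A = 1\<^sub>m n"
proof -
  from assms obtain B where B: "A * B = 1\<^sub>m n" "B * A = 1\<^sub>m (dim_row B)"
    by (auto simp: invertible_mat_def inverts_mat_def)
  have "dim_col B = n" using arg_cong[OF B(1), of dim_col] by simp
  moreover have "dim_row B = n" using arg_cong[OF B(2), of dim_col] assms by simp
  ultimately show ?thesis using that[of B] B by auto
qed

text \<open>Invertibility supplies a witness for the choice operator in \<open>minv\<close>.\<close>

lemma minv_inverse:
  fixes A :: "'a::semiring_1 mat"
  assumes "invertible_mat A" "A \<in> carrier_mat n n"
  shows "minv A \<in> carrier_mat n n" "A * minv A = 1\<^sub>m n" "minv A * A = 1\<^sub>m n"
proof -
  have "\<exists>B. B \<in> carrier_mat (dim_row A) (dim_row A) \<and> A * B = 1\<^sub>m (dim_row A) \<and> B * A = 1\<^sub>m (dim_row A)"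
    by (rule invertible_matE[OF assms]) (use assms in auto)
  from someI_ex[OF this, folded minv_def]
  show "minv A \<in> carrier_mat n n" "A * minv A = 1\<^sub>m n" "minv A * A = 1\<^sub>m n" using assms by auto
qed

text \<open>Every further factor shifts the support up by at least one diagonal: in a product term,
  \<open>l < i + k\<close> kills the power and \<open>j \<le> l\<close> kills the new
  factor.\<close>

lemma pow_strictly_upper_triangular:
  fixes A :: "'a::semiring_1 mat"
  assumes A: "A \<in> carrier_mat n n" and tri: "\<And>i j. i < n \<Longrightarrow> j \<le> i \<Longrightarrow> A $$ (i, j) = 0"
    and "i < n" "j < n" "j < i + k"
  shows "(A ^\<^sub>m k) $$ (i, j) = 0"
  using assms(3-)
proof (induction k arbitrary: j)
  case 0
  thus ?case using A by simp
next
  case (Suc k)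
  have P: "A ^\<^sub>m k \<in> carrier_mat n n" using A by simp
  have "(A ^\<^sub>m k) $$ (i, l) * A $$ (l, j) = 0" if "l < n" for l
  proof (cases "l < i + k")
    case True
    thus ?thesis using Suc.IH[of l] Suc.prems that by simp
  next
    case False
    thus ?thesis using tri[of l j] Suc.prems that by simp
  qed
  thus ?case using P A Suc.prems by (simp add: scalar_prod_def)
qed

lemma strictly_upper_triangular_nilpotent:
  fixes A :: "'a::semiring_1 mat"
  assumes A: "A \<in> carrier_mat n n" and tri: "\<And>i j. i < n \<Longrightarrow> j \<le> i \<Longrightarrow> A $$ (i, j) = 0"
    and "n \<le> k"
  shows "A ^\<^sub>m k = 0\<^sub>m n n"
proof (rule eq_matI)
  fix i j assume "i < dim_row (0\<^sub>m n n :: 'a mat)" "j < dim_col (0\<^sub>m n n :: 'a mat)"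
  with pow_strictly_upper_triangular[OF A tri, of i j k] assms(3)
  show "(A ^\<^sub>m k) $$ (i, j) = 0\<^sub>m n n $$ (i, j)" by simp
qed (use A in simp_all)

subsection \<open>Norms\<close>

text \<open>An auxiliary norm that is submultiplicative for rectangular matrices as well, so the
  transfer operators and the coarse level can be estimated with it; \<open>induced_norm\<close> has
  a single vector norm and dimension.\<close>

definition entry_norm :: "complex mat \<Rightarrow> real" where
  "entry_norm A = (\<Sum>i<dim_row A. \<Sum>j<dim_col A. cmod (A $$ (i, j)))"

lemma entry_norm_nonneg: "0 \<le> entry_norm A"
  by (simp add: entry_norm_def sum_nonneg)

lemma entry_norm_diff_le:
  assumes "A \<in> carrier_mat n m" "B \<in> carrier_mat n m"
  shows "entry_norm (A - B) \<le> entry_norm A + entry_norm B"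
proof -
  have d: "dim_row A = n" "dim_col A = m" "dim_row B = n" "dim_col B = m" using assms by auto
  show ?thesis unfolding entry_norm_def
    by (simp add: d flip: sum.distrib) (intro sum_mono norm_triangle_ineq4)
qed

lemma entry_norm_smult: "entry_norm (c \<cdot>\<^sub>m A) = cmod c * entry_norm A"
  by (simp add: entry_norm_def norm_mult sum_distrib_left)

text \<open>After the triangle inequality each row sum of \<open>B\<close> is replaced by the sum
  over all its entries, which no longer depends on the row.\<close>

lemma entry_norm_mult_le:
  assumes A: "A \<in> carrier_mat n m" and B: "B \<in> carrier_mat m l"
  shows "entry_norm (A * B) \<le> entry_norm A * entry_norm B"
proof -
  have d: "dim_row A = n" "dim_col A = m" "dim_row B = m" "dim_col B = l" using assms by auto
  have "entry_norm (A * B) = (\<Sum>i<n. \<Sum>k<l. cmod (\<Sum>j<m. A $$ (i, j) * B $$ (j, k)))"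
    unfolding entry_norm_def using d
    by (intro sum.cong) (auto simp: scalar_prod_def atLeast0LessThan)
  also have "\<dots> \<le> (\<Sum>i<n. \<Sum>k<l. \<Sum>j<m. cmod (A $$ (i, j)) * cmod (B $$ (j, k)))"
    by (intro sum_mono order_trans[OF norm_sum]) (simp add: norm_mult)
  also have "\<dots> = (\<Sum>i<n. \<Sum>j<m. cmod (A $$ (i, j)) * (\<Sum>k<l. cmod (B $$ (j, k))))"
    unfolding sum_distrib_left by (intro sum.cong refl sum.swap)
  also have "\<dots> \<le> (\<Sum>i<n. \<Sum>j<m. cmod (A $$ (i, j)) * entry_norm B)"
    unfolding entry_norm_def d
    by (intro sum_mono mult_left_mono member_le_sum[where f = "\<lambda>j. \<Sum>k<l. cmod (B $$ (j, k))"])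
       (auto intro: sum_nonneg)
  also have "\<dots> = entry_norm A * entry_norm B"
    by (simp add: entry_norm_def[of A] d sum_distrib_right)
  finally show ?thesis .
qed

definition vec_sum_norm :: "complex Matrix.vec \<Rightarrow> real" where
  "vec_sum_norm v = (\<Sum>i<dim_vec v. cmod (v $ i))"

lemma vec_sum_norm_nonneg: "0 \<le> vec_sum_norm v"
  by (simp add: vec_sum_norm_def sum_nonneg)

lemma vec_sum_norm_mult_mat_vec_le:
  assumes A: "A \<in> carrier_mat n m" and v: "v \<in> carrier_vec m"
  shows "vec_sum_norm (A *\<^sub>v v) \<le> entry_norm A * vec_sum_norm v"
proof -
  have d: "dim_row A = n" "dim_col A = m" "dim_vec v = m" using assms by auto
  have "vec_sum_norm (A *\<^sub>v v) = (\<Sum>i<n. cmod (\<Sum>j<m. A $$ (i, j) * v $ j))"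
    unfolding vec_sum_norm_def using d
    by (intro sum.cong) (auto simp: scalar_prod_def atLeast0LessThan)
  also have "\<dots> \<le> (\<Sum>i<n. \<Sum>j<m. cmod (A $$ (i, j)) * cmod (v $ j))"
    by (intro sum_mono order_trans[OF norm_sum]) (simp add: norm_mult)
  also have "\<dots> \<le> (\<Sum>i<n. \<Sum>j<m. cmod (A $$ (i, j)) * vec_sum_norm v)"
    unfolding vec_sum_norm_def d
    by (intro sum_mono mult_left_mono member_le_sum[where f = "\<lambda>j. cmod (v $ j)"]) auto
  also have "\<dots> = entry_norm A * vec_sum_norm v"
    by (simp add: entry_norm_def d sum_distrib_right)
  finally show ?thesis .
qed

section \<open>Comparison of an arbitrary vector norm with the coordinate sum norm, and its induced
  norm\<close>

context
  fixes n :: nat and nv :: "complex Matrix.vec \<Rightarrow> real"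
  assumes nv: "is_vec_norm n nv"
begin

lemma vec_norm_nonneg: "v \<in> carrier_vec n \<Longrightarrow> 0 \<le> nv v"
  using nv by (auto simp: is_vec_norm_def)

lemma vec_norm_zero_iff: "v \<in> carrier_vec n \<Longrightarrow> nv v = 0 \<longleftrightarrow> v = 0\<^sub>v n"
  using nv by (auto simp: is_vec_norm_def)

lemma vec_norm_smult: "v \<in> carrier_vec n \<Longrightarrow> nv (c \<cdot>\<^sub>v v) = cmod c * nv v"
  using nv by (auto simp: is_vec_norm_def)

lemma vec_norm_add_le:
  "v \<in> carrier_vec n \<Longrightarrow> w \<in> carrier_vec n \<Longrightarrow> nv (v + w) \<le> nv v + nv w"
  using nv by (auto simp: is_vec_norm_def)

lemma vec_norm_pos: "v \<in> carrier_vec n \<Longrightarrow> v \<noteq> 0\<^sub>v n \<Longrightarrow> 0 < nv v"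
  using vec_norm_nonneg vec_norm_zero_iff by (metis less_eq_real_def)

text \<open>The vector is built up one coordinate at a time through its truncations
  \<open>?p k\<close>; each step adds one scaled unit vector.\<close>

lemma vec_norm_le_sum_unit:
  assumes v: "v \<in> carrier_vec n"
  shows "nv v \<le> (\<Sum>i<n. cmod (v $ i) * nv (unit_vec n i))"
proof -
  let ?p = "\<lambda>k. Matrix.vec n (\<lambda>i. if i < k then v $ i else 0)"
  have "nv (?p k) \<le> (\<Sum>i<k. cmod (v $ i) * nv (unit_vec n i))" if "k \<le> n" for k
    using that
  proof (induction k)
    case 0
    have "?p 0 = 0\<^sub>v n" by (rule eq_vecI) simp_all
    thus ?case using vec_norm_zero_iff[of "0\<^sub>v n"] by simp
  next
    case (Suc k)
    have "?p (Suc k) = ?p k + v $ k \<cdot>\<^sub>v unit_vec n k"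
      by (rule eq_vecI) (use Suc.prems in \<open>auto simp: less_Suc_eq\<close>)
    hence "nv (?p (Suc k)) \<le> nv (?p k) + nv (v $ k \<cdot>\<^sub>v unit_vec n k)"
      using vec_norm_add_le[of "?p k" "v $ k \<cdot>\<^sub>v unit_vec n k"] by simp
    also have "nv (v $ k \<cdot>\<^sub>v unit_vec n k) = cmod (v $ k) * nv (unit_vec n k)"
      by (rule vec_norm_smult) simp
    finally show ?case using Suc by simp
  qed
  from this[of n] have "nv (?p n) \<le> (\<Sum>i<n. cmod (v $ i) * nv (unit_vec n i))" by simp
  also have "?p n = v" by (rule eq_vecI) (use v in auto)
  finally show ?thesis .
qed

lemma vec_norm_le_vec_sum_norm:
  obtains b where "0 < b" "\<And>v. v \<in> carrier_vec n \<Longrightarrow> nv v \<le> b * vec_sum_norm v"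
proof
  \<comment> \<open>The summand 1 keeps \<open>b\<close> positive even for \<open>n = 0\<close>,
    where the sum is empty.\<close>
  define b where "b = 1 + (\<Sum>i<n. nv (unit_vec n i))"
  have s: "0 \<le> (\<Sum>i<n. nv (unit_vec n i))" by (intro sum_nonneg vec_norm_nonneg) simp
  thus "0 < b" by (simp add: b_def)
  fix v :: "complex Matrix.vec" assume v: "v \<in> carrier_vec n"
  have "nv (unit_vec n i) \<le> b" if "i < n" for i
  proof -
    have "nv (unit_vec n i) \<le> (\<Sum>i<n. nv (unit_vec n i))"
      using that by (intro member_le_sum) (auto intro: vec_norm_nonneg)
    thus ?thesis by (simp add: b_def)
  qed
  hence "(\<Sum>i<n. cmod (v $ i) * nv (unit_vec n i)) \<le> (\<Sum>i<n. cmod (v $ i) * b)"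
    by (intro sum_mono mult_left_mono) auto
  also have "\<dots> = b * vec_sum_norm v"
    using v by (simp add: vec_sum_norm_def sum_distrib_left mult.commute)
  finally show "nv v \<le> b * vec_sum_norm v" using vec_norm_le_sum_unit[OF v] by simp
qed

text \<open>The reverse triangle inequality with the difference expanded in unit vectors. It yields
  continuity of the norm in the coordinates, as needed for a minimum on a compact set.\<close>

lemma vec_norm_diff_abs_le:
  assumes v: "v \<in> carrier_vec n" and w: "w \<in> carrier_vec n"
  shows "\<bar>nv v - nv w\<bar> \<le> (\<Sum>i<n. cmod (v $ i - w $ i) * nv (unit_vec n i))"
proof -
  have *: "nv x - nv y \<le> (\<Sum>i<n. cmod (x $ i - y $ i) * nv (unit_vec n i))"
    if x: "x \<in> carrier_vec n" and y: "y \<in> carrier_vec n" for x y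
  proof -
    have "x = y + (x - y)" by (rule eq_vecI) (use x y in auto)
    hence "nv x \<le> nv y + nv (x - y)"
      using vec_norm_add_le[of y "x - y"] x y by simp
    also have "nv (x - y) \<le> (\<Sum>i<n. cmod ((x - y) $ i) * nv (unit_vec n i))"
      using x y by (intro vec_norm_le_sum_unit) simp
    also have "\<dots> = (\<Sum>i<n. cmod (x $ i - y $ i) * nv (unit_vec n i))"
      by (rule sum.cong) (use x y in auto)
    finally show ?thesis by simp
  qed
  show ?thesis using *[OF v w] *[OF w v] by (simp add: abs_le_iff norm_minus_commute)
qed

text \<open>The unit sphere of the coordinate sum norm is compact in \<open>nat \<Rightarrow> complex\<close>, with coordinates
  beyond \<open>n\<close> set to zero.\<close>
lemma vec_sum_norm_le_vec_norm:
  obtains a where "0 < a" "\<And>v. v \<in> carrier_vec n \<Longrightarrow> a * vec_sum_norm v \<le> nv v"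
proof (cases "n = 0")
  case True
  show ?thesis
    by (rule that[of 1]) (use True vec_norm_nonneg in \<open>auto simp: vec_sum_norm_def\<close>)
next
  case False
  define B :: "nat \<Rightarrow> complex set" where "B = (\<lambda>i. if i < n then cball 0 1 else {0})"
  define K where "K = PiE UNIV B \<inter> {f. (\<Sum>i<n. cmod (f i)) = 1}"
  define g where "g = (\<lambda>f::nat \<Rightarrow> complex. nv (Matrix.vec n f))"
  \<comment> \<open>Tychonoff: every factor is a closed disc or a single point.\<close>
  have "compact (PiE UNIV B)"
    using compactin_PiE[of "\<lambda>_. euclidean" UNIV B]
    by (auto simp: euclidean_product_topology B_def)
  moreover have "closed {f::nat \<Rightarrow> complex. (\<Sum>i<n. cmod (f i)) = 1}"
    by (intro closed_Collect_eq continuous_on_sum continuous_on_norm continuous_on_const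
          continuous_on_product_coordinates)
  ultimately have cK: "compact K" unfolding K_def by (rule compact_Int_closed)
  \<comment> \<open>The first coordinate vector shows that the sphere is nonempty; it exists only
    for \<open>n > 0\<close>, hence the separate case before.\<close>
  let ?e = "\<lambda>i. if i = 0 then 1 else (0::complex)"
  have "(\<Sum>i<n. cmod (?e i)) = 1" using False by (subst sum.remove[of _ 0]) auto
  hence "?e \<in> K" using False by (auto simp: K_def B_def)
  hence neK: "K \<noteq> {}" by blast
  have contg: "continuous_on K g"
    unfolding continuous_on_def
  proof
    fix f assume "f \<in> K"
    have *: "((\<lambda>h. \<Sum>i<n. cmod (h i - f i) * nv (unit_vec n i)) \<longlongrightarrow>
            (\<Sum>i<n. cmod (f i - f i) * nv (unit_vec n i))) (at f within K)"
    proof (intro tendsto_intros)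
      fix i
      have "continuous_on K (\<lambda>h. h i)"
        by (rule continuous_on_subset[OF continuous_on_product_coordinates]) simp
      thus "((\<lambda>h. h i) \<longlongrightarrow> f i) (at f within K)"
        using \<open>f \<in> K\<close> by (auto simp: continuous_on_def)
    qed
    have "((\<lambda>h. g h - g f) \<longlongrightarrow> 0) (at f within K)"
    proof (rule Lim_null_comparison[OF always_eventually])
      show "\<forall>h. norm (g h - g f) \<le> (\<Sum>i<n. cmod (h i - f i) * nv (unit_vec n i))"
        using vec_norm_diff_abs_le[of "Matrix.vec n _" "Matrix.vec n f"] by (auto simp: g_def)
      show "((\<lambda>h. \<Sum>i<n. cmod (h i - f i) * nv (unit_vec n i)) \<longlongrightarrow> 0) (at f within K)"
        using * by simp
    qed
    thus "(g \<longlongrightarrow> g f) (at f within K)" by (simp add: LIM_zero_iff)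
  qed
  \<comment> \<open>The minimum of the norm on the sphere becomes the constant \<open>a\<close>. It
    is positive because the minimiser has coordinate sum norm 1 and so is not the zero
    vector.\<close>
  obtain f where f: "f \<in> K" "\<And>h. h \<in> K \<Longrightarrow> g f \<le> g h"
    using continuous_attains_inf[OF cK neK contg] by blast
  have "Matrix.vec n f \<noteq> 0\<^sub>v n"
  proof
    assume "Matrix.vec n f = 0\<^sub>v n"
    hence "f i = 0" if "i < n" for i using that by (metis index_vec index_zero_vec(1))
    hence "(\<Sum>i<n. cmod (f i)) = 0" by simp
    thus False using f(1) by (simp add: K_def)
  qed
  hence gf: "0 < g f" unfolding g_def by (intro vec_norm_pos) simp_all
  show ?thesis
  proof (rule that[OF gf])
    fix v :: "complex Matrix.vec" assume v: "v \<in> carrier_vec n"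
    define s where "s = vec_sum_norm v"
    have s0: "0 \<le> s" by (simp add: s_def vec_sum_norm_nonneg)
    show "g f * vec_sum_norm v \<le> nv v"
    proof (cases "s = 0")
      case True
      thus ?thesis using vec_norm_nonneg[OF v] by (simp add: s_def)
    next
      case s: False
      have dv: "dim_vec v = n" using v by simp
      \<comment> \<open>\<open>h\<close> is \<open>v\<close> rescaled to the sphere; homogeneity
        carries the estimate back to \<open>v\<close>.\<close>
      define h where "h = (\<lambda>i. if i < n then v $ i / complex_of_real s else 0)"
      have "(\<Sum>i<n. cmod (h i)) = (\<Sum>i<n. cmod (v $ i)) / s"
        using s0 by (simp add: h_def norm_divide sum_divide_distrib)
      hence one: "(\<Sum>i<n. cmod (h i)) = 1" using s by (simp add: s_def vec_sum_norm_def dv)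
      have "cmod (h i) \<le> 1" if "i < n" for i
        using member_le_sum[of i "{..<n}" "\<lambda>i. cmod (h i)"] that one by simp
      hence "h \<in> K" using one by (auto simp: K_def B_def h_def)
      hence "g f \<le> g h" by (rule f(2))
      moreover have "v = complex_of_real s \<cdot>\<^sub>v Matrix.vec n h"
        by (rule eq_vecI) (use s dv in \<open>auto simp: h_def\<close>)
      hence "nv v = s * g h" using vec_norm_smult[of "Matrix.vec n h" "complex_of_real s"] s0
        by (simp add: g_def)
      ultimately show ?thesis using s0 by (simp add: s_def mult.commute mult_left_mono)
    qed
  qed
qed

text \<open>Passes to the coordinate sum norm and back; the constant \<open>b / a\<close> is the
  ratio of the two equivalence constants and is the same for all matrices.\<close>

lemma vec_norm_mult_mat_vec_le:
  obtains c where "0 < c"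
    "\<And>A v. A \<in> carrier_mat n n \<Longrightarrow> v \<in> carrier_vec n \<Longrightarrow> nv (A *\<^sub>v v) \<le> c * entry_norm A * nv v"
proof -
  obtain a where a: "0 < a" "\<And>v. v \<in> carrier_vec n \<Longrightarrow> a * vec_sum_norm v \<le> nv v"
    by (rule vec_sum_norm_le_vec_norm) blast
  obtain b where b: "0 < b" "\<And>v. v \<in> carrier_vec n \<Longrightarrow> nv v \<le> b * vec_sum_norm v"
    by (rule vec_norm_le_vec_sum_norm) blast
  show ?thesis
  proof (rule that[of "b / a"])
    fix A :: "complex mat" and v :: "complex Matrix.vec" assume A: "A \<in> carrier_mat n n" and v: "v \<in> carrier_vec n"
    have "nv (A *\<^sub>v v) \<le> b * vec_sum_norm (A *\<^sub>v v)" using A v by (intro b) simp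
    also have "\<dots> \<le> b * (entry_norm A * vec_sum_norm v)"
      using b(1) vec_sum_norm_mult_mat_vec_le[OF A v] by simp
    also have "vec_sum_norm v \<le> nv v / a" using a v by (simp add: field_simps)
    hence "b * (entry_norm A * vec_sum_norm v) \<le> b * (entry_norm A * (nv v / a))"
      using b(1) entry_norm_nonneg by (intro mult_left_mono) auto
    finally show "nv (A *\<^sub>v v) \<le> b / a * entry_norm A * nv v" by simp
  qed (use a b in simp)
qed

text \<open>The preceding bound makes the set of quotients bounded above, so the supremum in
  \<open>induced_norm\<close> really is an upper bound.\<close>

lemma induced_norm_upper:
  assumes A: "A \<in> carrier_mat n n" and v: "v \<in> carrier_vec n"
  shows "nv (A *\<^sub>v v) \<le> induced_norm n nv A * nv v"
proof (cases "v = 0\<^sub>v n")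
  case True
  have "A *\<^sub>v v = 0\<^sub>v n" unfolding True by (rule eq_vecI) (use A in auto)
  thus ?thesis using vec_norm_zero_iff[of "0\<^sub>v n"] True by simp
next
  case False
  obtain c where c: "0 < c"
    "\<And>A v. A \<in> carrier_mat n n \<Longrightarrow> v \<in> carrier_vec n \<Longrightarrow> nv (A *\<^sub>v v) \<le> c * entry_norm A * nv v"
    by (rule vec_norm_mult_mat_vec_le) blast
  have "bdd_above {nv (A *\<^sub>v v) / nv v | v. v \<in> carrier_vec n \<and> v \<noteq> 0\<^sub>v n}"
    by (rule bdd_aboveI[of _ "c * entry_norm A"])
       (use c(2)[OF A] vec_norm_pos in \<open>auto simp: pos_divide_le_eq\<close>)
  hence "nv (A *\<^sub>v v) / nv v \<le> induced_norm n nv A"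
    unfolding induced_norm_def using v False by (intro cSup_upper) auto
  thus ?thesis using vec_norm_pos[OF v False] by (simp add: pos_divide_le_eq)
qed

lemma induced_norm_least:
  assumes n: "0 < n" and le: "\<And>v. v \<in> carrier_vec n \<Longrightarrow> nv (A *\<^sub>v v) \<le> c * nv v"
  shows "induced_norm n nv A \<le> c"
  unfolding induced_norm_def
proof (rule cSup_least)
  \<comment> \<open>A nonzero vector exists since \<open>0 < n\<close>; the supremum is thus taken
    over a nonempty set.\<close>
  have "unit_vec n 0 \<noteq> (0\<^sub>v n :: complex Matrix.vec)"
  proof
    assume "unit_vec n 0 = (0\<^sub>v n :: complex Matrix.vec)"
    hence "unit_vec n 0 $ 0 = (0\<^sub>v n :: complex Matrix.vec) $ 0" by simp
    thus False using n by simp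
  qed
  moreover have "unit_vec n 0 \<in> (carrier_vec n :: complex Matrix.vec set)" by simp
  ultimately show "{nv (A *\<^sub>v v) / nv v | v. v \<in> carrier_vec n \<and> v \<noteq> 0\<^sub>v n} \<noteq> {}" by blast
next
  fix x assume "x \<in> {nv (A *\<^sub>v v) / nv v | v. v \<in> carrier_vec n \<and> v \<noteq> 0\<^sub>v n}"
  thus "x \<le> c" using le vec_norm_pos by (auto simp: pos_divide_le_eq)
qed

lemma induced_norm_nonneg:
  assumes n: "0 < n" and A: "A \<in> carrier_mat n n"
  shows "0 \<le> induced_norm n nv A"
proof -
  let ?v = "unit_vec n 0 :: complex Matrix.vec"
  have "?v $ 0 \<noteq> 0\<^sub>v n $ 0" using n by simp
  hence "?v \<noteq> 0\<^sub>v n" by metis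
  hence p: "0 < nv ?v" by (intro vec_norm_pos) simp_all
  have "0 \<le> nv (A *\<^sub>v ?v)" using A by (intro vec_norm_nonneg) auto
  also have "\<dots> \<le> induced_norm n nv A * nv ?v" by (rule induced_norm_upper[OF A]) simp
  finally show ?thesis using p by (simp add: zero_le_mult_iff)
qed

lemma induced_norm_zero:
  assumes n: "0 < n"
  shows "induced_norm n nv (0\<^sub>m n n) = 0"
proof (rule antisym)
  show "induced_norm n nv (0\<^sub>m n n) \<le> 0"
  proof (rule induced_norm_least[OF n])
    fix v :: "complex Matrix.vec" assume v: "v \<in> carrier_vec n"
    have "0\<^sub>m n n *\<^sub>v v = 0\<^sub>v n" by (rule eq_vecI) (use v in auto)
    thus "nv (0\<^sub>m n n *\<^sub>v v) \<le> 0 * nv v" using vec_norm_zero_iff[of "0\<^sub>v n"] by simp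
  qed
qed (simp add: induced_norm_nonneg[OF n])

lemma induced_norm_mult_le:
  assumes n: "0 < n" and A: "A \<in> carrier_mat n n" and B: "B \<in> carrier_mat n n"
  shows "induced_norm n nv (A * B) \<le> induced_norm n nv A * induced_norm n nv B"
proof (rule induced_norm_least[OF n])
  fix v :: "complex Matrix.vec" assume v: "v \<in> carrier_vec n"
  have "nv (A * B *\<^sub>v v) = nv (A *\<^sub>v (B *\<^sub>v v))" using A B v by simp
  also have "\<dots> \<le> induced_norm n nv A * nv (B *\<^sub>v v)"
    using B v by (intro induced_norm_upper[OF A]) auto
  also have "\<dots> \<le> induced_norm n nv A * (induced_norm n nv B * nv v)"
    by (intro mult_left_mono induced_norm_upper[OF B v] induced_norm_nonneg[OF n A])
  finally show "nv (A * B *\<^sub>v v) \<le> induced_norm n nv A * induced_norm n nv B * nv v" by simp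
qed

lemma induced_norm_add_le:
  assumes n: "0 < n" and A: "A \<in> carrier_mat n n" and B: "B \<in> carrier_mat n n"
  shows "induced_norm n nv (A + B) \<le> induced_norm n nv A + induced_norm n nv B"
proof (rule induced_norm_least[OF n])
  fix v :: "complex Matrix.vec" assume v: "v \<in> carrier_vec n"
  have "nv ((A + B) *\<^sub>v v) = nv (A *\<^sub>v v + B *\<^sub>v v)"
    using A B v by (simp add: add_mult_distrib_mat_vec)
  also have "\<dots> \<le> nv (A *\<^sub>v v) + nv (B *\<^sub>v v)"
    using A B v by (intro vec_norm_add_le) auto
  also have "\<dots> \<le> induced_norm n nv A * nv v + induced_norm n nv B * nv v"
    by (intro add_mono induced_norm_upper A B v)
  finally show "nv ((A + B) *\<^sub>v v) \<le> (induced_norm n nv A + induced_norm n nv B) * nv v"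
    by (simp add: algebra_simps)
qed

lemma induced_norm_le_entry_norm:
  assumes n: "0 < n"
  obtains c where "0 < c" "\<And>A. A \<in> carrier_mat n n \<Longrightarrow> induced_norm n nv A \<le> c * entry_norm A"
  using vec_norm_mult_mat_vec_le induced_norm_least[OF n] by metis

end

subsection \<open>The stiff limit\<close>

text \<open>Multiplying the inverse equation by \<open>Z\<close> from the left gives \<mu> X = Z B X
  - Z. For \<mu> at least twice the norm of \<open>Z * B\<close>, the term containing
  \<open>X\<close> on the right is absorbed into half of the left-hand side.\<close>

lemma entry_norm_inverse_le:
  assumes D: "D \<in> carrier_mat n n" and Z: "Z \<in> carrier_mat n n" and B: "B \<in> carrier_mat n n"
    and X: "X \<in> carrier_mat n n" and ZD: "Z * D = 1\<^sub>m n"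
    and inv: "(B - complex_of_real \<mu> \<cdot>\<^sub>m D) * X = 1\<^sub>m n"
    and \<mu>: "0 < \<mu>" "2 * entry_norm (Z * B) \<le> \<mu>"
  shows "entry_norm X \<le> 2 * entry_norm Z / \<mu>"
proof -
  let ?c = "complex_of_real \<mu>"
  have BX: "B * X \<in> carrier_mat n n" and DX: "D * X \<in> carrier_mat n n"
    and cD: "?c \<cdot>\<^sub>m D \<in> carrier_mat n n" and ZB: "Z * B \<in> carrier_mat n n"
    and ZBX: "Z * B * X \<in> carrier_mat n n" and cX: "?c \<cdot>\<^sub>m X \<in> carrier_mat n n"
    using B D X Z by simp_all
  have "Z = Z * ((B - ?c \<cdot>\<^sub>m D) * X)" unfolding inv using Z by simp
  also have "(B - ?c \<cdot>\<^sub>m D) * X = B * X - ?c \<cdot>\<^sub>m (D * X)"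
    unfolding minus_mult_distrib_mat[OF B cD X] mult_smult_assoc_mat[OF D X] ..
  also have "Z * \<dots> = Z * (B * X) - ?c \<cdot>\<^sub>m (Z * (D * X))"
    using mult_minus_distrib_mat[OF Z BX, of "?c \<cdot>\<^sub>m (D * X)"] DX mult_smult_distrib[OF Z DX] by simp
  also have "Z * (D * X) = X"
    unfolding assoc_mult_mat[OF Z D X, symmetric] ZD using X by simp
  also have "Z * (B * X) = Z * B * X" by (rule assoc_mult_mat[OF Z B X, symmetric])
  finally have "Z * B * X - Z = Z * B * X - (Z * B * X - ?c \<cdot>\<^sub>m X)" by simp
  also have "\<dots> = ?c \<cdot>\<^sub>m X"
    by (rule eq_matI) (use carrier_matD[OF ZBX] carrier_matD[OF cX] in simp_all)
  finally have eq: "?c \<cdot>\<^sub>m X = Z * B * X - Z" ..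
  have "\<mu> * entry_norm X = entry_norm (?c \<cdot>\<^sub>m X)" using \<mu> by (simp add: entry_norm_smult)
  also have "\<dots> \<le> entry_norm (Z * B * X) + entry_norm Z"
    unfolding eq by (rule entry_norm_diff_le[OF ZBX Z])
  also have "entry_norm (Z * B * X) \<le> entry_norm (Z * B) * entry_norm X"
    by (rule entry_norm_mult_le[OF ZB X])
  also have "\<dots> \<le> \<mu> / 2 * entry_norm X"
    using \<mu> by (intro mult_right_mono entry_norm_nonneg) simp
  finally have "\<mu> * entry_norm X \<le> 2 * entry_norm Z" by simp
  thus ?thesis using \<mu> by (simp add: field_simps)
qed

text \<open>With S = S0 - F, powers telescope as \<open>S ^\<^sub>m Suc k - S0 ^\<^sub>m Suc k = (S
  ^\<^sub>m k - S0 ^\<^sub>m k) * S - S0 ^\<^sub>m k * F\<close>. The constant is chosen before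
  \<open>F\<close> and \<mu> and so is uniform in both.\<close>

lemma pow_perturbation_bound:
  assumes S0: "S0 \<in> carrier_mat n n" and d: "0 \<le> d"
  shows "\<exists>e\<ge>0. \<forall>F \<mu>. F \<in> carrier_mat n n \<longrightarrow> 1 \<le> \<mu> \<longrightarrow> entry_norm F \<le> d / \<mu> \<longrightarrow>
           entry_norm ((S0 - F) ^\<^sub>m k - S0 ^\<^sub>m k) \<le> e / \<mu>"
proof (induction k)
  case 0
  have "entry_norm ((S0 - F) ^\<^sub>m 0 - S0 ^\<^sub>m 0) = 0" if "F \<in> carrier_mat n n" for F
    using that S0 by (simp add: entry_norm_def)
  thus ?case by (intro exI[of _ 0]) simp
next
  case (Suc k)
  then obtain e where e: "0 \<le> e" "\<And>F \<mu>. F \<in> carrier_mat n n \<Longrightarrow> 1 \<le> \<mu> \<Longrightarrow> entry_norm F \<le> d / \<mu> \<Longrightarrow>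
           entry_norm ((S0 - F) ^\<^sub>m k - S0 ^\<^sub>m k) \<le> e / \<mu>" by blast
  \<comment> \<open>The two summands bound the two telescoping terms; in the first,
    \<open>1 \<le> \<mu>\<close> lets \<open>entry_norm S0 + d\<close> bound the norm of
    \<open>S0 - F\<close> for all admissible \<mu>.\<close>
  define e' where "e' = e * (entry_norm S0 + d) + entry_norm (S0 ^\<^sub>m k) * d"
  have "0 \<le> e'" using e(1) d by (simp add: e'_def entry_norm_nonneg)
  moreover have "entry_norm ((S0 - F) ^\<^sub>m Suc k - S0 ^\<^sub>m Suc k) \<le> e' / \<mu>"
    if F: "F \<in> carrier_mat n n" and \<mu>: "1 \<le> \<mu>" and Fd: "entry_norm F \<le> d / \<mu>" for F \<mu>
  proof -
    define S where "S = S0 - F"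
    define P where "P = S ^\<^sub>m k"
    define P0 where "P0 = S0 ^\<^sub>m k"
    have S: "S \<in> carrier_mat n n" and P: "P \<in> carrier_mat n n" and P0: "P0 \<in> carrier_mat n n"
      using S0 F by (simp_all add: minus_carrier_mat S_def P_def P0_def)
    have PP: "P - P0 \<in> carrier_mat n n" and PS: "P * S \<in> carrier_mat n n"
      and P0S: "P0 * S \<in> carrier_mat n n" and P0S0: "P0 * S0 \<in> carrier_mat n n"
      and P0F: "P0 * F \<in> carrier_mat n n"
      using P P0 S S0 F by (simp_all add: minus_carrier_mat)
    have PPS: "(P - P0) * S \<in> carrier_mat n n" using PP S by (rule mult_carrier_mat)
    have "(P - P0) * S - P0 * F = (P * S - P0 * S) - (P0 * S0 - P0 * S)"
    proof -
      have "P0 * S = P0 * S0 - P0 * F" unfolding S_def by (rule mult_minus_distrib_mat[OF P0 S0 F])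
      hence "P0 * F = P0 * S0 - P0 * S"
        by (intro eq_matI) (use carrier_matD[OF P0S0] carrier_matD[OF P0F] in simp_all)
      thus ?thesis using minus_mult_distrib_mat[OF P P0 S] by simp
    qed
    also have "\<dots> = P * S - P0 * S0"
      by (rule eq_matI)
         (use carrier_matD[OF PS] carrier_matD[OF P0S0] carrier_matD[OF P0S] in simp_all)
    finally have eq: "P * S - P0 * S0 = (P - P0) * S - P0 * F" ..
    have "entry_norm (P * S - P0 * S0) \<le> entry_norm ((P - P0) * S) + entry_norm (P0 * F)"
      unfolding eq by (rule entry_norm_diff_le[OF PPS P0F])
    also have "\<dots> \<le> entry_norm (P - P0) * entry_norm S + entry_norm P0 * entry_norm F"
      by (intro add_mono entry_norm_mult_le[OF PP S] entry_norm_mult_le[OF P0 F])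
    also have "\<dots> \<le> e / \<mu> * (entry_norm S0 + d) + entry_norm P0 * (d / \<mu>)"
    proof (intro add_mono mult_mono Fd order_refl entry_norm_nonneg)
      show "entry_norm (P - P0) \<le> e / \<mu>" unfolding P_def P0_def S_def by (rule e(2)[OF F \<mu> Fd])
      have "d / \<mu> \<le> d / 1" using d \<mu> by (intro divide_left_mono) auto
      thus "entry_norm S \<le> entry_norm S0 + d"
        unfolding S_def using entry_norm_diff_le[OF S0 F] Fd by simp
    qed (use e(1) \<mu> d in auto)
    also have "\<dots> = e' / \<mu>" by (simp add: e'_def P0_def add_divide_distrib)
    finally show ?thesis by (simp add: P_def P0_def S_def)
  qed
  ultimately show ?case by blast
qed

text \<open>With \<open>C = B - \<mu> K\<close> and \<open>K = D W\<close> one has \<open>C = P W + (B - W)\<close> for the smoother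
  \<open>P = 1 - \<mu> D\<close>, so the smoothing matrix is \<open>(1 - W) - P\<^sup>-\<^sup>1 (B - W)\<close>, an \<open>O(1/\<mu>)\<close> perturbation of
  \<open>1 - W\<close>; in the coarse correction the growth of \<open>C\<close> cancels the decay of \<open>Y\<close>.\<close>
lemma two_level_stiff_bound:
  fixes X Y :: "real \<Rightarrow> complex mat"
  assumes nv: "is_vec_norm n nv" and n: "0 < n"
    and B: "B \<in> carrier_mat n n" and K: "K \<in> carrier_mat n n" and D: "D \<in> carrier_mat n n"
    and W: "W \<in> carrier_mat n n" and Z: "Z \<in> carrier_mat n n"
    and DW: "D * W = K" and ZD: "Z * D = 1\<^sub>m n"
    and X: "\<And>\<mu>. 0 < \<mu> \<Longrightarrow> X \<mu> \<in> carrier_mat n n"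
      "\<And>\<mu>. 0 < \<mu> \<Longrightarrow> (1\<^sub>m n - complex_of_real \<mu> \<cdot>\<^sub>m D) * X \<mu> = 1\<^sub>m n"
      "\<And>\<mu>. 0 < \<mu> \<Longrightarrow> X \<mu> * (1\<^sub>m n - complex_of_real \<mu> \<cdot>\<^sub>m D) = 1\<^sub>m n"
    and Bc: "Bc \<in> carrier_mat m m" and Dc: "Dc \<in> carrier_mat m m" and Zc: "Zc \<in> carrier_mat m m"
    and ZDc: "Zc * Dc = 1\<^sub>m m"
    and Y: "\<And>\<mu>. 0 < \<mu> \<Longrightarrow> Y \<mu> \<in> carrier_mat m m"
      "\<And>\<mu>. 0 < \<mu> \<Longrightarrow> (Bc - complex_of_real \<mu> \<cdot>\<^sub>m Dc) * Y \<mu> = 1\<^sub>m m"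
    and U: "U \<in> carrier_mat n m" and V: "V \<in> carrier_mat m n"
  defines "C \<equiv> \<lambda>\<mu>. B - complex_of_real \<mu> \<cdot>\<^sub>m K"
  shows "\<exists>c>0. \<exists>c'\<ge>0. \<exists>\<mu>s>0. \<forall>\<mu>\<ge>\<mu>s.
    induced_norm n nv ((1\<^sub>m n - U * Y \<mu> * V * C \<mu>) * (1\<^sub>m n - X \<mu> * C \<mu>) ^\<^sub>m k)
      \<le> c * induced_norm n nv ((1\<^sub>m n - W) ^\<^sub>m k) + c' / \<mu>"
proof -
  define R where "R = B - W"
  have R: "R \<in> carrier_mat n n" using B W by (simp add: minus_carrier_mat R_def)
  define S0 where "S0 = 1\<^sub>m n - W"
  have S0: "S0 \<in> carrier_mat n n" using W by (simp add: minus_carrier_mat S0_def)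
  have S0k: "S0 ^\<^sub>m k \<in> carrier_mat n n" using S0 by simp
  have C: "C \<mu> \<in> carrier_mat n n" for \<mu> using B K by (simp add: minus_carrier_mat C_def)
  \<comment> \<open>Collects the thresholds for both inverse estimates; the summand 1 provides
    \<open>1 \<le> \<mu>\<close> for the power estimate. \<open>Z * 1\<^sub>m n\<close> appears
    because the smoother has the identity in place of \<open>B\<close>.\<close>
  define \<mu>s where "\<mu>s = 1 + 2 * entry_norm (Z * 1\<^sub>m n) + 2 * entry_norm (Zc * Bc)"
  have \<mu>s: "1 \<le> \<mu>s" "2 * entry_norm (Z * 1\<^sub>m n) \<le> \<mu>s" "2 * entry_norm (Zc * Bc) \<le> \<mu>s"
    using entry_norm_nonneg[of "Z * 1\<^sub>m n"] entry_norm_nonneg[of "Zc * Bc"] by (simp_all add: \<mu>s_def)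
  \<comment> \<open>\<open>d / \<mu>\<close> bounds the smoother perturbation
    \<open>X \<mu> * R\<close>.\<close>
  define d where "d = 2 * entry_norm Z * entry_norm R"
  have d: "0 \<le> d" by (simp add: d_def entry_norm_nonneg)
  obtain e where e: "0 \<le> e" "\<And>F \<mu>. F \<in> carrier_mat n n \<Longrightarrow> 1 \<le> \<mu> \<Longrightarrow> entry_norm F \<le> d / \<mu> \<Longrightarrow>
      entry_norm ((S0 - F) ^\<^sub>m k - S0 ^\<^sub>m k) \<le> e / \<mu>"
    using pow_perturbation_bound[OF S0 d, of k] by blast
  \<comment> \<open>A bound for the coarse correction, uniform in \<mu>: the factor 1/\<mu> from
    \<open>Y \<mu>\<close> cancels against \<open>\<mu> * (entry_norm B + entry_norm K)\<close>,
    which bounds the norm of \<open>C \<mu>\<close>.\<close>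
  define g where "g = entry_norm (1\<^sub>m n) + entry_norm U * (2 * entry_norm Zc) * entry_norm V
      * (entry_norm B + entry_norm K)"
  have g: "0 \<le> g" by (simp add: g_def entry_norm_nonneg)
  obtain q where q: "0 < q" "\<And>A. A \<in> carrier_mat n n \<Longrightarrow> induced_norm n nv A \<le> q * entry_norm A"
    by (rule induced_norm_le_entry_norm[OF nv n]) blast
  have main: "induced_norm n nv ((1\<^sub>m n - U * Y \<mu> * V * C \<mu>) * (1\<^sub>m n - X \<mu> * C \<mu>) ^\<^sub>m k)
      \<le> (q * g + 1) * induced_norm n nv (S0 ^\<^sub>m k) + q * g * (q * e) / \<mu>" if "\<mu>s \<le> \<mu>" for \<mu>
  proof -
    have \<mu>1: "1 \<le> \<mu>" and \<mu>: "0 < \<mu>" using that \<mu>s by simp_all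
    let ?c = "complex_of_real \<mu>"
    note X = X[OF \<mu>] and Y = Y[OF \<mu>]
    have cK: "?c \<cdot>\<^sub>m K \<in> carrier_mat n n" and cD: "?c \<cdot>\<^sub>m D \<in> carrier_mat n n"
      and I: "1\<^sub>m n \<in> carrier_mat n n"
      using K D by simp_all
    define P where "P = 1\<^sub>m n - ?c \<cdot>\<^sub>m D"
    have P: "P \<in> carrier_mat n n" using D by (simp add: minus_carrier_mat P_def)
    have PW: "P * W \<in> carrier_mat n n" and XR: "X \<mu> * R \<in> carrier_mat n n"
      and XC: "X \<mu> * C \<mu> \<in> carrier_mat n n" using P W X R C[of \<mu>] by simp_all
    have nX: "entry_norm (X \<mu>) \<le> 2 * entry_norm Z / \<mu>"
      by (rule entry_norm_inverse_le[OF D Z I X(1) ZD X(2) \<mu>]) (use \<mu>s that in simp)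
    have nY: "entry_norm (Y \<mu>) \<le> 2 * entry_norm Zc / \<mu>"
      by (rule entry_norm_inverse_le[OF Dc Zc Bc Y(1) ZDc Y(2) \<mu>]) (use \<mu>s that in simp)
    have PWeq: "P * W = W - ?c \<cdot>\<^sub>m K"
      unfolding P_def minus_mult_distrib_mat[OF I cD W] mult_smult_assoc_mat[OF D W] DW
      using W by simp
    have Ceq: "C \<mu> = P * W + R" unfolding PWeq
      by (rule eq_matI)
         (use carrier_matD[OF B] carrier_matD[OF W] carrier_matD[OF K] in \<open>simp_all add: C_def R_def\<close>)
    have "X \<mu> * C \<mu> = X \<mu> * (P * W) + X \<mu> * R"
      unfolding Ceq by (rule mult_add_distrib_mat[OF X(1) PW R])
    also have "X \<mu> * (P * W) = W"
      unfolding assoc_mult_mat[OF X(1) P W, symmetric] using X(3) W by (simp add: P_def)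
    finally have XCeq: "X \<mu> * C \<mu> = W + X \<mu> * R" .
    have Seq: "1\<^sub>m n - X \<mu> * C \<mu> = S0 - X \<mu> * R" unfolding XCeq S0_def
      by (rule eq_matI) (use carrier_matD[OF W] carrier_matD[OF XR] in simp_all)
    define S where "S = (1\<^sub>m n - X \<mu> * C \<mu>) ^\<^sub>m k"
    have S: "S \<in> carrier_mat n n" using XC by (simp add: minus_carrier_mat S_def)
    have "entry_norm (X \<mu> * R) \<le> entry_norm (X \<mu>) * entry_norm R" by (rule entry_norm_mult_le[OF X(1) R])
    also have "\<dots> \<le> 2 * entry_norm Z / \<mu> * entry_norm R"
      by (rule mult_right_mono[OF nX entry_norm_nonneg])
    finally have "entry_norm (X \<mu> * R) \<le> d / \<mu>" by (simp add: d_def)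
    from e(2)[OF XR \<mu>1 this] have nS: "entry_norm (S - S0 ^\<^sub>m k) \<le> e / \<mu>" by (simp add: S_def Seq)
    define G where "G = 1\<^sub>m n - U * Y \<mu> * V * C \<mu>"
    have UY: "U * Y \<mu> \<in> carrier_mat n m" using U Y by simp
    have UYV: "U * Y \<mu> * V \<in> carrier_mat n n" using UY V by simp
    have UYVC: "U * Y \<mu> * V * C \<mu> \<in> carrier_mat n n" using UYV C by simp
    have G: "G \<in> carrier_mat n n" unfolding G_def by (rule minus_carrier_mat[OF UYVC])
    have "entry_norm (C \<mu>) \<le> entry_norm B + \<mu> * entry_norm K"
      unfolding C_def using entry_norm_diff_le[OF B cK] \<mu> by (simp add: entry_norm_smult)
    also have "\<dots> \<le> \<mu> * (entry_norm B + entry_norm K)"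
      using \<mu>1 mult_right_mono[OF \<mu>1 entry_norm_nonneg[of B]] by (simp add: algebra_simps)
    finally have nC: "entry_norm (C \<mu>) \<le> \<mu> * (entry_norm B + entry_norm K)" .
    have "entry_norm (U * Y \<mu> * V * C \<mu>) \<le> entry_norm (U * Y \<mu> * V) * entry_norm (C \<mu>)"
      by (rule entry_norm_mult_le[OF UYV C])
    also have "\<dots> \<le> (entry_norm (U * Y \<mu>) * entry_norm V) * entry_norm (C \<mu>)"
      by (rule mult_right_mono[OF entry_norm_mult_le[OF UY V] entry_norm_nonneg])
    also have "\<dots> \<le> (entry_norm U * entry_norm (Y \<mu>) * entry_norm V) * entry_norm (C \<mu>)"
      by (intro mult_right_mono entry_norm_mult_le[OF U Y(1)] entry_norm_nonneg)
    also have "\<dots> \<le> (entry_norm U * (2 * entry_norm Zc / \<mu>) * entry_norm V)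
        * (\<mu> * (entry_norm B + entry_norm K))"
      using \<mu> by (intro mult_mono nY nC order_refl) (simp_all add: entry_norm_nonneg)
    also have "\<dots> = g - entry_norm (1\<^sub>m n)" using \<mu> by (simp add: g_def)
    finally have nG: "entry_norm G \<le> g"
      unfolding G_def using entry_norm_diff_le[OF I UYVC] by simp
    have iG: "induced_norm n nv G \<le> q * g"
      by (rule order_trans[OF q(2)[OF G]]) (use nG q(1) in simp)
    have dS: "S - S0 ^\<^sub>m k \<in> carrier_mat n n" by (rule minus_carrier_mat[OF S0k])
    have "S = S0 ^\<^sub>m k + (S - S0 ^\<^sub>m k)"
      by (rule eq_matI) (use carrier_matD[OF S] carrier_matD[OF S0k] in simp_all)
    hence "induced_norm n nv S \<le> induced_norm n nv (S0 ^\<^sub>m k) + induced_norm n nv (S - S0 ^\<^sub>m k)"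
      using induced_norm_add_le[OF nv n S0k dS] by simp
    also have "induced_norm n nv (S - S0 ^\<^sub>m k) \<le> q * (e / \<mu>)"
      by (rule order_trans[OF q(2)[OF dS] mult_left_mono[OF nS]]) (use q(1) in simp)
    finally have iS: "induced_norm n nv S \<le> induced_norm n nv (S0 ^\<^sub>m k) + q * (e / \<mu>)" by simp
    have p: "0 \<le> induced_norm n nv (S0 ^\<^sub>m k)" by (rule induced_norm_nonneg[OF nv n S0k])
    have "induced_norm n nv (G * S) \<le> induced_norm n nv G * induced_norm n nv S"
      by (rule induced_norm_mult_le[OF nv n G S])
    also have "\<dots> \<le> q * g * (induced_norm n nv (S0 ^\<^sub>m k) + q * (e / \<mu>))"
      using q(1) g by (intro mult_mono iG iS induced_norm_nonneg[OF nv n S]) simp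
    also have "\<dots> \<le> (q * g + 1) * induced_norm n nv (S0 ^\<^sub>m k) + q * g * (q * e) / \<mu>"
      using p by (simp add: algebra_simps)
    finally show ?thesis by (simp add: G_def S_def)
  qed
  \<comment> \<open>Only nonnegativity of \<open>g\<close> is at hand, so the added 1 secures a
    strictly positive leading constant.\<close>
  have "0 < q * g + 1" "0 \<le> q * g * (q * e)" "0 < \<mu>s"
    using q(1) g e(1) \<mu>s(1) by (auto simp: add_nonneg_pos)
  with main show ?thesis unfolding S0_def by blast
qed

text \<open>By multiplicativity of the determinant, nonsingularity of the collocation matrix passes
  to \<open>UQ\<close>; transposing the factorisation then lets the inverse cancel the left
  factor.\<close>

lemma LU_trick:
  fixes LQ UQ :: "real mat"
  assumes M: "0 < M"
    and LU: "LQ \<in> carrier_mat M M" "UQ \<in> carrier_mat M M" "transpose_mat (coll_Q M) = LQ * UQ"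
  shows "invertible_mat (transpose_mat UQ)" "minv (transpose_mat UQ) * coll_Q M = transpose_mat LQ"
proof -
  let ?QD = "transpose_mat UQ"
  have QD: "?QD \<in> carrier_mat M M" and LT: "transpose_mat LQ \<in> carrier_mat M M" using LU by simp_all
  have "Determinant.det LQ * Determinant.det UQ = Determinant.det (coll_Q M)"
    using det_mult[OF LU(1,2)] Determinant.det_transpose[OF coll_Q_carrier[of M]] LU(3) by simp
  hence "Determinant.det UQ \<noteq> 0" using det_coll_Q_nonzero[OF M] by auto
  hence "Determinant.det ?QD \<noteq> 0" using Determinant.det_transpose[OF LU(2)] by simp
  \<comment> \<open>A nonzero determinant gives a unit of the matrix ring, from which the inverse is
    read off; \<open>()\<close> only fills the ring's record extension.\<close>
  from det_non_zero_imp_unit[OF QD this, of "()"]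
  obtain J where "J \<in> carrier_mat M M" "J * ?QD = 1\<^sub>m M" "?QD * J = 1\<^sub>m M"
    by (auto simp: Units_def ring_mat_def)
  thus inv: "invertible_mat ?QD"
    unfolding invertible_mat_def inverts_mat_def using carrier_matD[OF QD] by auto
  have "coll_Q M = transpose_mat (LQ * UQ)" by (simp flip: LU(3))
  also have "\<dots> = ?QD * transpose_mat LQ" by (rule transpose_mult[OF LU(1,2)])
  finally have "minv ?QD * coll_Q M = minv ?QD * (?QD * transpose_mat LQ)" by simp
  also have "\<dots> = transpose_mat LQ"
    unfolding assoc_mult_mat[OF minv_inverse(1)[OF inv QD] QD LT, symmetric]
      minv_inverse(3)[OF inv QD] using LT by simp
  finally show "minv ?QD * coll_Q M = transpose_mat LQ" .
qed

lemma kron3_mult: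
  fixes X :: "'a::comm_semiring_1 mat"
  assumes "X \<in> carrier_mat a b" "Y \<in> carrier_mat c d" "X' \<in> carrier_mat b e" "Y' \<in> carrier_mat d f"
  shows "kron (kron (1\<^sub>m l) X) Y * kron (kron (1\<^sub>m l) X') Y' = kron (kron (1\<^sub>m l) (X * X')) (Y * Y')"
proof -
  have "kron (1\<^sub>m l) X \<in> carrier_mat (l * a) (l * b)" "kron (1\<^sub>m l) X' \<in> carrier_mat (l * b) (l * e)"
    by (rule kron_carrier[OF one_carrier_mat assms(1)], rule kron_carrier[OF one_carrier_mat assms(3)])
  from kron_mult_kron[OF this(1) assms(2) this(2) assms(4)] show ?thesis
    by (simp add: kron_mult_kron[OF one_carrier_mat assms(1) one_carrier_mat assms(3)])
qed

section \<open>The PFASST matrices in the form of the two-level estimate\<close>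

lemma E_H_carrier: "kron (E_mat L) (H_mat M N) \<in> carrier_mat (L * M * N) (L * M * N)"
  by (rule carrier_matI) (simp_all add: kron_def E_mat_def H_mat_def N_mat_def mult.assoc)

text \<open>Reorders the difference so that the part independent of \<mu> stands apart from the part
  linear in \<mu>. It serves both levels, as \<open>Ptilde_mat\<close> is an instance of
  \<open>C_mat\<close>.\<close>

lemma C_mat_eq:
  assumes "kron (kron (1\<^sub>m L) (cmat Q)) A \<in> carrier_mat (L * M * N) (L * M * N)"
  shows "C_mat L M N \<mu> Q A = (1\<^sub>m (L * M * N) - kron (E_mat L) (H_mat M N))
    - complex_of_real \<mu> \<cdot>\<^sub>m kron (kron (1\<^sub>m L) (cmat Q)) A"
  unfolding C_mat_def
  by (rule eq_matI) (use carrier_matD[OF assms] carrier_matD[OF E_H_carrier[of L M N]] in simp_all)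

theorem theorem4:
  fixes L M N Mc Nc k :: nat
    and A :: "complex mat" and Ac :: "complex mat"
    and LQ UQ QD QDc :: "real mat"
    and TFCQ TFCA TCFQ TCFA :: "real mat"
  assumes dims: "0 < L" "0 < M" "0 < N" "0 < Mc" "0 < Nc" "Mc \<le> M" "Nc \<le> N"
    and A: "A \<in> carrier_mat N N" "invertible_mat A"
    and Ac: "Ac \<in> carrier_mat Nc Nc" "invertible_mat Ac"
    and LU: "LQ \<in> carrier_mat M M" "UQ \<in> carrier_mat M M"
            "transpose_mat (coll_Q M) = LQ * UQ"
            "unit_lower_triangular LQ" "upper_triangular UQ"
            "QD = transpose_mat UQ"
    and QDc: "QDc \<in> carrier_mat Mc Mc" "lower_triangular QDc" "invertible_mat QDc"
    and transfer: "TFCQ \<in> carrier_mat Mc M" "TFCA \<in> carrier_mat Nc N"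
                  "TCFQ \<in> carrier_mat M Mc" "TCFA \<in> carrier_mat N Nc"
    and commute: "kron (E_mat L) (H_mat Mc Nc) * kron (kron (1\<^sub>m L) (cmat TFCQ)) (cmat TFCA)
                  = kron (kron (1\<^sub>m L) (cmat TFCQ)) (cmat TFCA) * kron (E_mat L) (H_mat M N)"
    and invertible: "\<And>\<mu>. \<mu> > 0 \<Longrightarrow> invertible_mat (Phat_mat L M N \<mu> QD A)"
                    "\<And>\<mu>. \<mu> > 0 \<Longrightarrow> invertible_mat (Ptilde_mat L Mc Nc \<mu> QDc Ac)"
  shows "\<forall>nv. is_vec_norm (L*M*N) nv \<longrightarrow>
     (\<exists>c>0. \<exists>c'\<ge>0. \<exists>\<mu>s>0. \<forall>\<mu>\<ge>\<mu>s.
        induced_norm (L*M*N) nv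
          (T_PFASST L M N Mc Nc QD QDc A Ac
             (kron (kron (1\<^sub>m L) (cmat TFCQ)) (cmat TFCA))
             (kron (kron (1\<^sub>m L) (cmat TCFQ)) (cmat TCFA)) \<mu> k)
        \<le> c * induced_norm (L*M*N) nv
               (kron (kron (1\<^sub>m L)
                  ((1\<^sub>m M - cmat (minv QD) * cmat (coll_Q M)) ^\<^sub>m k)) (1\<^sub>m N))
          + c' / \<mu>)
     \<and> (M \<le> k \<longrightarrow>
          ((\<lambda>\<mu>. induced_norm (L*M*N) nv
             (T_PFASST L M N Mc Nc QD QDc A Ac
               (kron (kron (1\<^sub>m L) (cmat TFCQ)) (cmat TFCA))
               (kron (kron (1\<^sub>m L) (cmat TCFQ)) (cmat TCFA)) \<mu> k)) \<longlongrightarrow> 0) at_top)"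
proof (intro allI impI)
  fix nv assume nv: "is_vec_norm (L * M * N) nv"
  define n where "n = L * M * N"
  define m where "m = L * Mc * Nc"
  have n: "0 < n" using dims by (simp add: n_def)
  have QD: "QD \<in> carrier_mat M M" using LU by simp
  note QDinv = LU_trick[OF dims(2) LU(1-3), folded LU(6)]
  note J = minv_inverse[OF QDinv(1) QD]
  note Jc = minv_inverse[OF QDc(3,1)]
  note Ai = minv_inverse[OF A(2,1)]
  note Aci = minv_inverse[OF Ac(2,1)]
  have Q: "coll_Q M \<in> carrier_mat M M" by simp
  define W1 where "W1 = cmat (minv QD) * cmat (coll_Q M)"
  \<comment> \<open>\<open>D\<close>, \<open>K\<close> and \<open>Dc\<close> are the coefficients of
    -\<mu> in smoother, collocation and coarse matrix; \<open>Z\<close> and \<open>Zc\<close> invert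
    \<open>D\<close> and \<open>Dc\<close> factor by factor. \<open>W\<close> solves
    \<open>D * W = K\<close>; since \<open>A\<close> is common to both, its space factor is the
    identity.\<close>
  define D where "D = kron (kron (1\<^sub>m L) (cmat QD)) A"
  define K where "K = kron (kron (1\<^sub>m L) (cmat (coll_Q M))) A"
  define W where "W = kron (kron (1\<^sub>m L) W1) (1\<^sub>m N)"
  define Z where "Z = kron (kron (1\<^sub>m L) (cmat (minv QD))) (minv A)"
  define Dc where "Dc = kron (kron (1\<^sub>m L) (cmat QDc)) Ac"
  define Zc where "Zc = kron (kron (1\<^sub>m L) (cmat (minv QDc))) (minv Ac)"
  define U where "U = kron (kron (1\<^sub>m L) (cmat TCFQ)) (cmat TCFA)"
  define V where "V = kron (kron (1\<^sub>m L) (cmat TFCQ)) (cmat TFCA)"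
  define B where "B = 1\<^sub>m n - kron (E_mat L) (H_mat M N)"
  define Bc where "Bc = 1\<^sub>m m - kron (E_mat L) (H_mat Mc Nc)"
  have cQ: "cmat (coll_Q M) \<in> carrier_mat M M" and cQD: "cmat QD \<in> carrier_mat M M"
    and cJ: "cmat (minv QD) \<in> carrier_mat M M" and cQDc: "cmat QDc \<in> carrier_mat Mc Mc"
    and cJc: "cmat (minv QDc) \<in> carrier_mat Mc Mc"
    using Q QD J(1) QDc(1) Jc(1) by simp_all
  have W1: "W1 \<in> carrier_mat M M" using cJ cQ by (simp add: W1_def)
  have carr: "D \<in> carrier_mat n n" "K \<in> carrier_mat n n" "W \<in> carrier_mat n n" "Z \<in> carrier_mat n n"
    "Dc \<in> carrier_mat m m" "Zc \<in> carrier_mat m m" "U \<in> carrier_mat n m" "V \<in> carrier_mat m n"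
    unfolding D_def K_def W_def Z_def Dc_def Zc_def U_def V_def n_def m_def
    by (intro kron_carrier one_carrier_mat cQ cQD cJ cQDc cJc W1 A(1) Ac(1) Ai(1) Aci(1)
          map_carrier_mat[THEN iffD2] transfer)+
  have EH: "kron (E_mat L) (H_mat M N) \<in> carrier_mat n n"
    "kron (E_mat L) (H_mat Mc Nc) \<in> carrier_mat m m"
    unfolding n_def m_def by (rule E_H_carrier)+
  have Bs: "B \<in> carrier_mat n n" "Bc \<in> carrier_mat m m" using EH by (simp_all add: minus_carrier_mat B_def Bc_def)
  have QDW1: "cmat QD * W1 = cmat (coll_Q M)"
    unfolding W1_def assoc_mult_mat[OF cQD cJ cQ, symmetric] of_real_hom.mat_hom_mult[OF QD J(1), symmetric] J(2)
      of_real_hom.mat_hom_one by (rule left_mult_one_mat[OF cQ])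
  have DW: "D * W = K"
    unfolding D_def W_def K_def kron3_mult[OF cQD A(1) W1 one_carrier_mat] QDW1 using A(1) by simp
  have ZD: "Z * D = 1\<^sub>m n"
    unfolding Z_def D_def kron3_mult[OF cJ Ai(1) cQD A(1)] of_real_hom.mat_hom_mult[OF J(1) QD, symmetric] J(3) Ai(3)
    by (simp add: of_real_hom.mat_hom_one kron_one n_def)
  have ZDc: "Zc * Dc = 1\<^sub>m m"
    unfolding Zc_def Dc_def kron3_mult[OF cJc Aci(1) cQDc Ac(1)] of_real_hom.mat_hom_mult[OF Jc(1) QDc(1), symmetric] Jc(3) Aci(3)
    by (simp add: of_real_hom.mat_hom_one kron_one m_def)
  have Phat: "Phat_mat L M N \<mu> QD A = 1\<^sub>m n - complex_of_real \<mu> \<cdot>\<^sub>m D" for \<mu>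
    by (simp add: Phat_mat_def D_def n_def)
  have C: "C_mat L M N \<mu> (coll_Q M) A = B - complex_of_real \<mu> \<cdot>\<^sub>m K" for \<mu>
    unfolding B_def K_def n_def by (rule C_mat_eq) (use carr(2) in \<open>simp add: K_def n_def\<close>)
  have Ptilde: "Ptilde_mat L Mc Nc \<mu> QDc Ac = Bc - complex_of_real \<mu> \<cdot>\<^sub>m Dc" for \<mu>
    unfolding Bc_def Dc_def m_def Ptilde_mat_def
    by (rule C_mat_eq) (use carr(5) in \<open>simp add: Dc_def m_def\<close>)
  have Phat_carr: "Phat_mat L M N \<mu> QD A \<in> carrier_mat n n"
    and Ptilde_carr: "Ptilde_mat L Mc Nc \<mu> QDc Ac \<in> carrier_mat m m" for \<mu>
    unfolding Phat Ptilde using carr by (simp_all add: minus_carrier_mat)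
  note X = minv_inverse[OF invertible(1) Phat_carr]
  note Y = minv_inverse[OF invertible(2) Ptilde_carr]
  let ?T = "\<lambda>\<mu>. T_PFASST L M N Mc Nc QD QDc A Ac V U \<mu> k"
  let ?S = "kron (kron (1\<^sub>m L) ((1\<^sub>m M - W1) ^\<^sub>m k)) (1\<^sub>m N)"
  have T: "?T \<mu> = (1\<^sub>m n - U * minv (Ptilde_mat L Mc Nc \<mu> QDc Ac) * V * (B - complex_of_real \<mu> \<cdot>\<^sub>m K))
      * (1\<^sub>m n - minv (Phat_mat L M N \<mu> QD A) * (B - complex_of_real \<mu> \<cdot>\<^sub>m K)) ^\<^sub>m k" for \<mu>
    by (simp add: T_PFASST_def C n_def)
  have IW1: "1\<^sub>m M - W1 \<in> carrier_mat M M" by (rule minus_carrier_mat[OF W1])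
  \<comment> \<open>Writing the identity as a Kronecker product confines the subtraction to the
    middle factor, so powers act there alone.\<close>
  have W0: "1\<^sub>m n - W = kron (kron (1\<^sub>m L) (1\<^sub>m M - W1)) (1\<^sub>m N)"
  proof -
    have "kron (1\<^sub>m L) (1\<^sub>m M - W1) = 1\<^sub>m (L * M) - kron (1\<^sub>m L) W1"
      unfolding kron_minus_right[OF one_carrier_mat one_carrier_mat W1] kron_one ..
    thus ?thesis
      using kron_minus_left[OF one_carrier_mat one_carrier_mat kron_carrier[OF one_carrier_mat W1], of L N]
      by (simp add: kron_one W_def n_def)
  qed
  have Wk: "(1\<^sub>m n - W) ^\<^sub>m k = ?S"
    unfolding W0 kron_pow[OF kron_carrier[OF one_carrier_mat IW1] one_carrier_mat]
      kron_pow[OF one_carrier_mat IW1] one_mat_pow ..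
  have bound: "\<exists>c>0. \<exists>c'\<ge>0. \<exists>\<mu>s>0. \<forall>\<mu>\<ge>\<mu>s. induced_norm n nv (?T \<mu>) \<le> c * induced_norm n nv ?S + c' / \<mu>"
    unfolding T Wk[symmetric]
    by (rule two_level_stiff_bound[OF _ n Bs(1) carr(2,1,3,4) DW ZD _ _ _ Bs(2) carr(5,6) ZDc _ _ carr(7,8)])
       (use nv X Y in \<open>simp_all flip: n_def Phat Ptilde\<close>)
  have "((\<lambda>\<mu>. induced_norm n nv (?T \<mu>)) \<longlongrightarrow> 0) at_top" if k: "M \<le> k"
  proof -
    have "(1\<^sub>m M - W1) $$ (i, j) = 0" if "i < M" "j \<le> i" for i j
    proof -
      \<comment> \<open>The unit diagonal and triangular shape of \<open>LQ\<close> make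
        \<open>1\<^sub>m M - W1\<close> strictly upper triangular.\<close>
      have "W1 = cmat (transpose_mat LQ)"
        unfolding W1_def of_real_hom.mat_hom_mult[OF J(1) Q, symmetric] QDinv(2) ..
      thus ?thesis using that LU(1,4)
        by (cases "i = j") (auto simp: unit_lower_triangular_def lower_triangular_def)
    qed
    from strictly_upper_triangular_nilpotent[OF IW1 this k]
    have "(1\<^sub>m M - W1) ^\<^sub>m k = 0\<^sub>m M M" by simp
    hence S: "?S = 0\<^sub>m n n"
      using kron_zero_left[OF one_carrier_mat, of "L * M" "L * M" N]
      by (simp add: kron_zero_right[OF one_carrier_mat] n_def)
    have S0: "induced_norm n nv ?S = 0" unfolding S using induced_norm_zero nv n by (simp add: n_def)
    \<comment> \<open>The limit matrix has norm 0, so only the \<open>c' / \<mu>\<close> term of the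
      bound remains.\<close>
    obtain c' \<mu>s where c': "0 < \<mu>s" "\<And>\<mu>. \<mu>s \<le> \<mu> \<Longrightarrow> induced_norm n nv (?T \<mu>) \<le> c' / \<mu>"
      using bound unfolding S0 by auto
    have Tc: "?T \<mu> \<in> carrier_mat n n" if "0 < \<mu>" for \<mu>
    proof -
      have BK: "B - complex_of_real \<mu> \<cdot>\<^sub>m K \<in> carrier_mat n n" using carr(2) by (simp add: minus_carrier_mat)
      note left = minus_carrier_mat[OF mult_carrier_mat[OF mult_carrier_mat[OF
            mult_carrier_mat[OF carr(7) Y(1)[OF that]] carr(8)] BK]]
      note right = pow_carrier_mat[OF minus_carrier_mat[OF mult_carrier_mat[OF X(1)[OF that] BK]]]
      show ?thesis unfolding T by (rule mult_carrier_mat[OF left right])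
    qed
    show ?thesis
    proof (rule tendsto_sandwich)
      \<comment> \<open>Both preconditioners are known to be invertible for positive \<mu>, which
        fixes the dimensions of the iteration matrix; nonnegativity is therefore claimed only
        eventually.\<close>
      show "eventually (\<lambda>\<mu>. 0 \<le> induced_norm n nv (?T \<mu>)) at_top"
        using eventually_gt_at_top[of 0]
        by eventually_elim (use induced_norm_nonneg nv n Tc in \<open>simp add: n_def\<close>)
      show "eventually (\<lambda>\<mu>. induced_norm n nv (?T \<mu>) \<le> c' / \<mu>) at_top"
        using eventually_ge_at_top[of \<mu>s] by eventually_elim (rule c'(2))
      show "((\<lambda>\<mu>. c' / \<mu>) \<longlongrightarrow> 0) at_top"
        by (intro tendsto_divide_0[OF tendsto_const] filterlim_at_top_imp_at_infinity filterlim_ident)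
    qed simp
  qed
  with bound show "(\<exists>c>0. \<exists>c'\<ge>0. \<exists>\<mu>s>0. \<forall>\<mu>\<ge>\<mu>s.
        induced_norm (L*M*N) nv
          (T_PFASST L M N Mc Nc QD QDc A Ac
             (kron (kron (1\<^sub>m L) (cmat TFCQ)) (cmat TFCA))
             (kron (kron (1\<^sub>m L) (cmat TCFQ)) (cmat TCFA)) \<mu> k)
        \<le> c * induced_norm (L*M*N) nv
               (kron (kron (1\<^sub>m L)
                  ((1\<^sub>m M - cmat (minv QD) * cmat (coll_Q M)) ^\<^sub>m k)) (1\<^sub>m N))
          + c' / \<mu>)
     \<and> (M \<le> k \<longrightarrow>
          ((\<lambda>\<mu>. induced_norm (L*M*N) nv
             (T_PFASST L M N Mc Nc QD QDc A Ac
               (kron (kron (1\<^sub>m L) (cmat TFCQ)) (cmat TFCA))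
               (kron (kron (1\<^sub>m L) (cmat TCFQ)) (cmat TCFA)) \<mu> k)) \<longlongrightarrow> 0) at_top)"
    unfolding U_def V_def W1_def n_def by blast
qed

end
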